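(* Let $\lambda\mapsto\lambda^*$ be any size-preserving involution on the set of all integer partitions. Let $g(k)$ be the number of generalized flagpole partitions of size $k$ (defined using this involution). (a) For all $k$, $$g(k)\ \ge\ \sum_{j=1}^{k-1}2\max\left\{0,\ p(j)-2\sum_{i=k-3-j}^{j}q_i(j)\right\}.$$ (b) For any real $c<1$ and all sufficiently large $k$, $g(k)>p(k)^c$. Here $p(j)$ is the number of integer partitions of size $j$, and $q_i(j)$ is the number of partitions $\lambda$ of size $j$ with $\lambda_1+\ell(\lambda)-1=i$.
   Context: A quasi-Dyck vector (QDV) is an integer sequence $v=v_1v_2\cdots v_n$ with $v_1=0$ and $v_{i+1}\le v_i+1$ for all $i<n$. We use word notation; $i^c$ means $c$ copies of the symbol $i$; $W^{+}$ adds $1$ to each entry of $W$. Dyck classes $[v]$ are the equivalence classes of the equivalence relation on QDVs generated by $v\sim 0v^+$. An integer partition $\lambda$ (with $\ell(\lambda)$ positive parts and $\lambda_i=0$ for $i>\ell(\lambda)$; the zero partition $\langle 0\rangle=[0]$ is allowed) is identified with the Dyck class consisting of all QDVs $\mathrm{QDV}_n(\lambda)=(0-\lambda_n,1-\lambda_{n-1},\ldots,n-1-\lambda_1)$, $n>\ell(\lambda)$; this is a bijection between partitions and Dyck classes. The maps. $\mathrm{NU}_1$ is defined on $D_1=\{\gamma:\gamma_1\le\ell(\gamma)+2\}$ by $\mathrm{NU}_1(\gamma)=\langle\ell+1,\gamma_1-1,\ldots,\gamma_\ell-1\rangle$, $\ell=\ell(\gamma)$ (zero parts dropped); it is a bijection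 from $D_1$ onto $C_1=\{\gamma\ne\langle 0\rangle:\gamma_1\ge\ell(\gamma)\}$. $\mathrm{NU}_2$ is defined by two rules. Rule (a): $\mathrm{NU}_2([012^hA(-1)^{h-1}])=[00^{h-1}1A1^h]$ for $h\ge 2$ and $A=A_1\cdots A_s$ a list of integers that is empty or satisfies all $A_i\le 2$, $A_s\ge 0$, $A_{i+1}\le A_i+1$ for $i<s$. Rule (b): $\mathrm{NU}_2([012^kB(-1)^k])=[00^kB01^k]$ for $k\ge 1$ and $B=B_1\cdots B_s$ a list of integers that is empty or satisfies all $B_i\le 2$, $B_1\le 1$, $B_s\ge -1$, $B_{i+1}\le B_i+1$ for $i<s$. $\mathrm{NU}_2$ is a bijection from its domain $D_2$ onto its image $C_2$, with $D_1\cap D_2=\emptyset=C_1\cap C_2$; $\mathrm{NU}$ is the combined bijection $D_1\cup D_2\to C_1\cup C_2$ and $\mathrm{ND}$ is its inverse. For nonzero $\mu=\langle r^{n_r}\cdots 2^{n_2}1^{n_1}\rangle$ with $n_r>0$ ($n_i$ parts equal to $i$), $B_\mu=01^{n_1}01^{n_2}\cdots 01^{n_r}$; $B_{\langle 0\rangle}$ is empty; $\mathrm{TI}(\mu)=[0B_\mu]$. $\mathrm{TI}_2(\mu)$ is the Dyck class obtained by starting at $\mathrm{TI}(\mu)$ and iterating $\mathrm{ND}$ as many times as possible (this always terminates). For a partition $\lambda$ and $a\ge 2$, $v(\lambda,a,0)=0012^aB_\lambda^+$ and $v(\lambda,a,1)=0012^{a-1}B_\lambda^+1$; both have length $L=a+3+\lambda_1+\ell(\lambda)$.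 Relative to a size-preserving involution $\rho\mapsto\rho^*$ on all partitions, a partition $\mu$ is a generalized flagpole partition iff $\mathrm{TI}_2(\mu)=[v(\lambda,a,\epsilon)]$ for some partition $\lambda$, $a\ge 2$, $\epsilon\in\{0,1\}$, whose length $L$ satisfies $L\ge 5+\lambda_1+\ell(\lambda)$ and $L\ge 5+\lambda_1^*+\ell(\lambda^* )$ (where $\lambda_1^*$ is the largest part of $\lambda^*$). Conventions: $q_i(j)=0$ for $i\le 0$, and a sum over an empty range is $0$. *)

theory Defs
  imports Complex_Main
begin

section \<open>Integer partitions\<close>

text \<open>A partition is the weakly decreasing list of its positive parts; the zero partition is
  \<^term>\<open>[]\<close>, the size is \<^const>\<open>sum_list\<close> and the number of parts is \<^const>\<open>length\<close>.\<close>

definition is_partition :: "nat list \<Rightarrow> bool" where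
  "is_partition lam \<longleftrightarrow> sorted_wrt (\<ge>) lam \<and> (\<forall>x\<in>set lam. 0 < x)"

text \<open>Parts are indexed from 1, as in \<open>\<lambda>\<^sub>1 \<ge> \<lambda>\<^sub>2 \<ge> \<dots>\<close>; this is only used with \<open>i \<ge> 1\<close>.\<close>

definition part :: "nat list \<Rightarrow> nat \<Rightarrow> nat" where
  "part lam i = (if 1 \<le> i \<and> i \<le> length lam then lam ! (i - 1) else 0)"

definition num_partitions :: "nat \<Rightarrow> nat" where
  "num_partitions j = card {lam. is_partition lam \<and> sum_list lam = j}"

text \<open>The index \<open>i\<close> is an integer because the sum in the theorem may start at a negative index.\<close>

definition q_count :: "int \<Rightarrow> nat \<Rightarrow> nat" where
  "q_count i j = (if i \<le> 0 then 0
     else card {lam. is_partition lam \<and> sum_list lam = j \<and> int (part lam 1) + int (length lam) - 1 = i})"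

definition size_preserving_involution :: "(nat list \<Rightarrow> nat list) \<Rightarrow> bool" where
  "size_preserving_involution star \<longleftrightarrow>
     (\<forall>lam. is_partition lam \<longrightarrow>
        is_partition (star lam) \<and> sum_list (star lam) = sum_list lam \<and> star (star lam) = lam)"


section \<open>Quasi-Dyck vectors and Dyck classes\<close>

definition qdv :: "int list \<Rightarrow> bool" where
  "qdv v \<longleftrightarrow> v \<noteq> [] \<and> v ! 0 = 0 \<and> (\<forall>i. Suc i < length v \<longrightarrow> v ! Suc i \<le> v ! i + 1)"

abbreviation incr :: "int list \<Rightarrow> int list" where
  "incr w \<equiv> map (\<lambda>x. x + 1) w"

definition dyck_step :: "int list \<Rightarrow> int list \<Rightarrow> bool" where
  "dyck_step v w \<longleftrightarrow> qdv v \<and> w = 0 # incr v"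

definition dyck_class :: "int list \<Rightarrow> int list set" where
  "dyck_class v = {w. qdv w \<and> equivclp dyck_step v w}"

text \<open>With 0-based list positions, the entry at position \<open>i\<close> is \<open>i - \<lambda>\<^bsub>n-i\<^esub>\<close>.\<close>

definition QDV :: "nat \<Rightarrow> nat list \<Rightarrow> int list" where
  "QDV n lam = map (\<lambda>i. int i - int (part lam (n - i))) [0..<n]"

definition class_of_partition :: "nat list \<Rightarrow> int list set" where
  "class_of_partition lam = {QDV n lam | n. length lam < n}"


section \<open>The maps NU and ND\<close>

text \<open>The partial maps are given by their graphs on Dyck classes; a partition is passed to them
  as the class \<^const>\<open>class_of_partition\<close> identified with it.\<close>

inductive NU1 :: "int list set \<Rightarrow> int list set \<Rightarrow> bool" where
  "is_partition \<gamma> \<Longrightarrow> part \<gamma> 1 \<le> length \<gamma> + 2 \<Longrightarrow>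
     NU1 (class_of_partition \<gamma>)
         (class_of_partition (filter (\<lambda>x. 0 < x) ((length \<gamma> + 1) # map (\<lambda>x. x - 1) \<gamma>)))"

text \<open>The condition \<open>A\<^bsub>i+1\<^esub> \<le> A\<^sub>i + 1\<close> on consecutive entries.\<close>

definition slow_growth :: "int list \<Rightarrow> bool" where
  "slow_growth A \<longleftrightarrow> (\<forall>i. Suc i < length A \<longrightarrow> A ! Suc i \<le> A ! i + 1)"

inductive NU2 :: "int list set \<Rightarrow> int list set \<Rightarrow> bool" where
  rule_a:
  "2 \<le> h \<Longrightarrow> A = [] \<or> ((\<forall>x\<in>set A. x \<le> 2) \<and> 0 \<le> last A \<and> slow_growth A) \<Longrightarrow>
     NU2 (dyck_class ([0, 1] @ replicate h 2 @ A @ replicate (h - 1) (- 1)))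
         (dyck_class ([0] @ replicate (h - 1) 0 @ [1] @ A @ replicate h 1))"
| rule_b:
  "1 \<le> k \<Longrightarrow>
     B = [] \<or> ((\<forall>x\<in>set B. x \<le> 2) \<and> hd B \<le> 1 \<and> - 1 \<le> last B \<and> slow_growth B) \<Longrightarrow>
     NU2 (dyck_class ([0, 1] @ replicate k 2 @ B @ replicate k (- 1)))
         (dyck_class ([0] @ replicate k 0 @ B @ [0] @ replicate k 1))"

definition NU :: "int list set \<Rightarrow> int list set \<Rightarrow> bool" where
  "NU C D \<longleftrightarrow> NU1 C D \<or> NU2 C D"

definition ND :: "int list set \<Rightarrow> int list set \<Rightarrow> bool" where
  "ND = NU\<inverse>\<inverse>"


section \<open>Generalized flagpole partitions\<close>

definition B_word :: "nat list \<Rightarrow> int list" where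
  "B_word \<mu> = concat (map (\<lambda>i. 0 # replicate (count_list \<mu> i) 1) [1..<part \<mu> 1 + 1])"

definition TI :: "nat list \<Rightarrow> int list set" where
  "TI \<mu> = dyck_class (0 # B_word \<mu>)"

text \<open>The class reached from \<^term>\<open>TI \<mu>\<close> by iterating \<^const>\<open>ND\<close> until it is no longer defined.
  It exists and is unique because \<^const>\<open>ND\<close> is the graph of a partial map and the iteration
  terminates.\<close>

definition TI2 :: "nat list \<Rightarrow> int list set" where
  "TI2 \<mu> = (THE D. ND\<^sup>*\<^sup>* (TI \<mu>) D \<and> \<not> (\<exists>E. ND D E))"

text \<open>The third argument is only used with the values 0 and 1.\<close>

definition flagpole_vec :: "nat list \<Rightarrow> nat \<Rightarrow> nat \<Rightarrow> int list" where
  "flagpole_vec lam a \<epsilon> =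
    (if \<epsilon> = 0 then [0, 0, 1] @ replicate a 2 @ incr (B_word lam)
     else [0, 0, 1] @ replicate (a - 1) 2 @ incr (B_word lam) @ [1])"

definition generalized_flagpole :: "(nat list \<Rightarrow> nat list) \<Rightarrow> nat list \<Rightarrow> bool" where
  "generalized_flagpole star \<mu> \<longleftrightarrow> is_partition \<mu> \<and>
     (\<exists>lam a \<epsilon>. is_partition lam \<and> 2 \<le> a \<and> \<epsilon> \<in> {0, 1} \<and>
        TI2 \<mu> = dyck_class (flagpole_vec lam a \<epsilon>) \<and>
        length (flagpole_vec lam a \<epsilon>) \<ge> 5 + part lam 1 + length lam \<and>
        length (flagpole_vec lam a \<epsilon>) \<ge> 5 + part (star lam) 1 + length (star lam))"

definition num_flagpoles :: "(nat list \<Rightarrow> nat list) \<Rightarrow> nat \<Rightarrow> nat" where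
  "num_flagpoles star k = card {\<mu>. generalized_flagpole star \<mu> \<and> sum_list \<mu> = k}"

end

theory Submission
  imports Defs "HOL-Real_Asymp.Real_Asymp"
begin

text \<open>Write a class as an infinite word \<open>\<dots>, -2, -1, w\<close> up to a shift of all letters. Then \<open>NU\<^sub>1\<close> removes
  the last letter \<open>y\<close> of the initial run \<open>\<dots>, y - 1, y\<close> and appends \<open>y - 1\<close>. On words over \<open>{-1, 0, 1, 2}\<close>
  with no 2 after a \<open>-1\<close> either this or one of the two rules of \<open>NU\<^sub>2\<close> applies, the result is a word of
  the same kind, and the deficit does not change. The sum of the letters drops in each step until the first
  letter is \<open>-1\<close>; shifting the letters then adds a letter 0 to the word. A word over \<open>{0, 1, 2}\<close> with a letter
  2 has at most deficit + 2 zeros, so the orbit reaches a binary word. Every binary word lies on the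
  \<open>NU\<^sub>1\<close>-orbit of some \<open>TI(\<mu>)\<close> with \<open>|\<mu>|\<close> equal to the deficit, and as \<open>NU\<close> is injective, a flagpole vector,
  which is not in the image of \<open>NU\<close>, is \<open>TI\<^sub>2(\<mu>)\<close>. Its deficit is \<open>L - 2 + |\<lambda>|\<close>, so (a) is a count of
  the admissible \<open>\<lambda>\<close> of each size \<open>j < k\<close>, with two choices of \<open>\<epsilon>\<close>.

  For (b) take the single term \<open>j = k - d\<close> with \<open>d\<close> of order \<open>k\<^sup>0\<^sup>.\<^sup>9\<close>. Three applications of
  \<open>m p(n - m) \<le> \<surd>(2n) p(n)\<close> show that the subtracted sum is at most \<open>p(j)/4\<close>. Cutting partitions
  of \<open>k\<close> in two gives \<open>p(k) \<le> (k + 1)\<^sup>3 p(k - d) p(d)\<close>, where \<open>ln p(d)\<close> is of order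
  \<open>k\<^sup>0\<^sup>.\<^sup>4\<^sup>5 ln k\<close>, which is negligible against \<open>ln p(k)\<close>, of order at least \<open>\<surd>k\<close>.\<close>

section \<open>Quasi-Dyck vectors and their classes\<close>

abbreviation shift :: "int list \<Rightarrow> int list" where
  "shift v \<equiv> 0 # incr v"

lemma slow_growth_Nil [simp]: "slow_growth []"
  by (simp add: slow_growth_def)

lemma slow_growth_Cons: "slow_growth (x # xs) \<longleftrightarrow> xs = [] \<or> (hd xs \<le> x + 1 \<and> slow_growth xs)"
proof (cases xs)
  case Nil
  then show ?thesis by (simp add: slow_growth_def)
next
  case (Cons y ys)
  have "slow_growth (x # xs) \<longleftrightarrow> (\<forall>i. i < length xs \<longrightarrow> xs ! i \<le> (x # xs) ! i + 1)"
    by (simp add: slow_growth_def)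
  also have "\<dots> \<longleftrightarrow> xs ! 0 \<le> x + 1 \<and> (\<forall>i. Suc i < length xs \<longrightarrow> xs ! Suc i \<le> xs ! i + 1)"
  proof
    assume *: "\<forall>i. i < length xs \<longrightarrow> xs ! i \<le> (x # xs) ! i + 1"
    show "xs ! 0 \<le> x + 1 \<and> (\<forall>i. Suc i < length xs \<longrightarrow> xs ! Suc i \<le> xs ! i + 1)"
      using *[rule_format, of 0] *[rule_format, of "Suc _"] Cons by auto
  next
    assume *: "xs ! 0 \<le> x + 1 \<and> (\<forall>i. Suc i < length xs \<longrightarrow> xs ! Suc i \<le> xs ! i + 1)"
    show "\<forall>i. i < length xs \<longrightarrow> xs ! i \<le> (x # xs) ! i + 1"
    proof (intro allI impI)
      fix i assume "i < length xs"
      then show "xs ! i \<le> (x # xs) ! i + 1"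
        using * by (cases i) auto
    qed
  qed
  finally show ?thesis
    using Cons by (simp add: slow_growth_def)
qed

lemma slow_growth_append:
  "slow_growth (xs @ ys) \<longleftrightarrow>
     slow_growth xs \<and> slow_growth ys \<and> (xs = [] \<or> ys = [] \<or> hd ys \<le> last xs + 1)"
  by (induction xs) (auto simp: slow_growth_Cons)

lemma slow_growth_replicate [simp]: "slow_growth (replicate n x)"
proof (induction n)
  case (Suc n)
  then show ?case by (cases n) (auto simp: slow_growth_Cons)
qed simp

lemma slow_growth_incr [simp]: "slow_growth (incr w) \<longleftrightarrow> slow_growth w"
  by (induction w) (auto simp: slow_growth_Cons hd_map)

text \<open>Two consecutive letters never differ by more than 1, so for binary words and for words
  over -1 and 0 the growth condition is automatic.\<close>

lemma slow_growth_two_letters: "set w \<subseteq> {a, a + 1} \<Longrightarrow> slow_growth w"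
proof (induction w)
  case (Cons x w)
  then show ?case by (cases w) (auto simp: slow_growth_Cons)
qed simp

lemma qdv_iff: "qdv v \<longleftrightarrow> v \<noteq> [] \<and> hd v = 0 \<and> slow_growth v"
  by (auto simp: qdv_def slow_growth_def hd_conv_nth)

lemma qdv_Cons: "qdv (x # u) \<longleftrightarrow> x = 0 \<and> (u = [] \<or> (hd u \<le> 1 \<and> slow_growth u))"
  by (auto simp: qdv_iff slow_growth_Cons)

lemma qdv_shift: "qdv v \<Longrightarrow> qdv (shift v)"
  by (auto simp: qdv_iff slow_growth_Cons hd_map)

section \<open>Dyck classes as chains under \<open>shift\<close>\<close>

lemma inj_shift: "shift v = shift w \<Longrightarrow> v = w"
  by (metis (no_types, lifting) add_right_cancel inj_on_def inj_on_mapI list.inject map_injective)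

lemma length_shift_pow: "length ((shift ^^ i) v) = length v + i"
  by (induction i) auto

text \<open>The last letter serves as a counter of shifts: comparing last letters shows how far
  apart two vectors of one class are.\<close>

lemma last_shift_pow: "v \<noteq> [] \<Longrightarrow> last ((shift ^^ i) v) = last v + int i"
proof (induction i)
  case (Suc i)
  have "(shift ^^ i) v \<noteq> []"
    using Suc.prems length_shift_pow[of i v] by (metis add_is_0 length_0_conv)
  then show ?case
    using Suc by (simp add: last_map)
qed simp

text \<open>A second letter other than 1 therefore marks the shortest vector of a class, called
  reduced below.\<close>

lemma hd_tl_shift: "qdv v \<Longrightarrow> hd (tl (shift v)) = 1"
  by (auto simp: qdv_iff hd_map)

lemma qdv_shift_pow: "qdv v \<Longrightarrow> qdv ((shift ^^ i) v)"
  by (induction i) (auto intro: qdv_shift)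

text \<open>Since \<open>shift\<close> is an injective function, a zigzag of steps collapses: a step
  up followed by a step down returns to its start. Only pure ascents and pure descents
  remain.\<close>

lemma equivclp_dyck_stepD:
  assumes "equivclp dyck_step v w"
  shows "\<exists>i. w = (shift ^^ i) v \<or> v = (shift ^^ i) w"
  using assms
proof (induction rule: equivclp_induct)
  case base
  show ?case by (rule exI[of _ 0]) simp
next
  case (step y z)
  from step.IH obtain i where i: "y = (shift ^^ i) v \<or> v = (shift ^^ i) y" by blast
  from step.hyps(2) consider "z = shift y" | "y = shift z"
    by (auto simp: dyck_step_def)
  then show ?case
  proof cases
    case 1
    from i show ?thesis
    proof
      assume "y = (shift ^^ i) v"
      then have "z = (shift ^^ Suc i) v" using 1 by simp
      then show ?thesis by blast
    next
      assume v: "v = (shift ^^ i) y"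
      show ?thesis
      proof (cases i)
        case 0
        then have "z = (shift ^^ Suc 0) v" using 1 v by simp
        then show ?thesis by blast
      next
        case (Suc j)
        then have "v = (shift ^^ j) z" using 1 v by (simp only: funpow_Suc_right o_apply)
        then show ?thesis by blast
      qed
    qed
  next
    case 2
    from i show ?thesis
    proof
      assume y: "y = (shift ^^ i) v"
      show ?thesis
      proof (cases i)
        case 0
        then have "v = (shift ^^ Suc 0) z" using 2 y by simp
        then show ?thesis by blast
      next
        case (Suc j)
        then have "shift z = shift ((shift ^^ j) v)" using 2 y by simp
        then have "z = (shift ^^ j) v" by (rule inj_shift)
        then show ?thesis by blast
      qed
    next
      assume "v = (shift ^^ i) y"
      then have "v = (shift ^^ Suc i) z" using 2 by (simp only: funpow_Suc_right o_apply)
      then show ?thesis by blast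
    qed
  qed
qed

lemma dyck_class_eqI: "equivclp dyck_step v w \<Longrightarrow> dyck_class v = dyck_class w"
  unfolding dyck_class_def
  by (auto intro: equivclp_trans equivclp_sym)

lemma dyck_class_shift: "qdv v \<Longrightarrow> dyck_class (shift v) = dyck_class v"
  by (rule dyck_class_eqI, rule equivclp_sym) (auto simp: dyck_step_def)

lemma dyck_class_eqD:
  assumes "dyck_class v = dyck_class w" "qdv w"
  shows "\<exists>i. w = (shift ^^ i) v \<or> v = (shift ^^ i) w"
proof -
  have "w \<in> dyck_class w" using assms(2) by (simp add: dyck_class_def)
  then have "w \<in> dyck_class v" by (simp only: assms(1))
  then have "equivclp dyck_step v w" by (simp add: dyck_class_def)
  then show ?thesis by (rule equivclp_dyck_stepD)
qed

text \<open>If \<open>w\<close> were a proper shift of \<open>v\<close>, its second letter would be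
  1.\<close>

lemma dyck_class_reduced:
  assumes "dyck_class v = dyck_class w" "qdv v" "qdv w" "hd (tl w) \<noteq> 1"
  shows "\<exists>i. v = (shift ^^ i) w"
proof -
  obtain i where i: "w = (shift ^^ i) v \<or> v = (shift ^^ i) w"
    using dyck_class_eqD[OF assms(1,3)] by blast
  then show ?thesis
  proof
    assume w: "w = (shift ^^ i) v"
    show ?thesis
    proof (cases i)
      case 0
      then have "v = (shift ^^ 0) w" using w by simp
      then show ?thesis by blast
    next
      case (Suc j)
      have "hd (tl w) = 1"
        using hd_tl_shift[OF qdv_shift_pow[OF assms(2), of j]] unfolding w Suc funpow.simps o_apply .
      then show ?thesis using assms(4) by simp
    qed
  next
    assume "v = (shift ^^ i) w"
    then show ?thesis by (intro exI[of _ i])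
  qed
qed

lemma dyck_class_reduced_eq:
  assumes "dyck_class v = dyck_class w" "qdv v" "qdv w" "hd (tl v) \<noteq> 1" "hd (tl w) \<noteq> 1"
  shows "v = w"
proof -
  obtain i where i: "v = (shift ^^ i) w" using dyck_class_reduced assms by blast
  obtain j where j: "w = (shift ^^ j) v" using dyck_class_reduced assms by metis
  have "i = 0" using arg_cong[OF i, of length] arg_cong[OF j, of length]
    by (simp add: length_shift_pow)
  then show ?thesis using i by simp
qed

section \<open>Partitions as quasi-Dyck vectors\<close>

lemma part_beyond: "length lam < i \<Longrightarrow> part lam i = 0"
  by (simp add: part_def)

lemma part_pos: "is_partition lam \<Longrightarrow> 1 \<le> i \<Longrightarrow> i \<le> length lam \<Longrightarrow> 0 < part lam i"
  by (auto simp: part_def is_partition_def)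

lemma part_antimono: "is_partition lam \<Longrightarrow> 1 \<le> i \<Longrightarrow> i \<le> j \<Longrightarrow> part lam j \<le> part lam i"
proof -
  assume a: "is_partition lam" "1 \<le> i" "i \<le> j"
  show ?thesis
  proof (cases "j \<le> length lam \<and> i < j")
    case True
    then have "lam ! (j - 1) \<le> lam ! (i - 1)"
      using a by (auto simp: is_partition_def sorted_wrt_iff_nth_less)
    then show ?thesis using True a by (simp add: part_def)
  next
    case False
    then show ?thesis using a by (auto simp: part_def)
  qed
qed

lemma length_QDV [simp]: "length (QDV n lam) = n"
  by (simp add: QDV_def)

lemma QDV_nth: "i < n \<Longrightarrow> QDV n lam ! i = int i - int (part lam (n - i))"
  by (simp add: QDV_def)

lemma QDV_Suc: "length lam \<le> n \<Longrightarrow> QDV (Suc n) lam = shift (QDV n lam)"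
proof (rule nth_equalityI)
  fix i assume n: "length lam \<le> n" and i: "i < length (QDV (Suc n) lam)"
  show "QDV (Suc n) lam ! i = shift (QDV n lam) ! i"
  proof (cases i)
    case 0
    then show ?thesis using n by (simp add: QDV_nth part_beyond)
  next
    case (Suc j)
    then show ?thesis using i by (simp add: QDV_nth)
  qed
qed simp

lemma qdv_QDV: "is_partition lam \<Longrightarrow> length lam < n \<Longrightarrow> qdv (QDV n lam)"
proof -
  assume a: "is_partition lam" "length lam < n"
  have "QDV n lam ! Suc i \<le> QDV n lam ! i + 1" if "Suc i < n" for i
    using that part_antimono[OF a(1), of "n - Suc i" "n - i"] by (simp add: QDV_nth)
  moreover have "QDV n lam ! 0 = 0"
    using a by (simp add: QDV_nth part_beyond)
  moreover have "QDV n lam \<noteq> []" using a length_QDV[of n lam] by (metis less_nat_zero_code list.size(3))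
  ultimately show ?thesis by (simp add: qdv_def)
qed

text \<open>One step down the chain: the second entry is 1, which forces
  \<open>part lam (n - 1) = 0\<close>, so \<open>lam\<close> has fewer than \<open>n - 1\<close>
  parts and the shorter vector still represents it.\<close>

lemma QDV_eq_shiftD:
  assumes "is_partition lam" "QDV n lam = shift w" "qdv w" "length lam < n"
  shows "\<exists>m. n = Suc m \<and> length lam < m \<and> w = QDV m lam"
proof -
  have n: "n = Suc (length w)" using arg_cong[OF assms(2), of length] by simp
  have w: "w \<noteq> []" "w ! 0 = 0" using assms(3) by (auto simp: qdv_def)
  then have "shift w ! 1 = 1" by simp
  then have "QDV n lam ! 1 = 1" using assms(2) by simp
  then have "part lam (n - 1) = 0" using w n by (subst (asm) QDV_nth) auto
  then have "length lam < n - 1"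
    using part_pos[OF assms(1), of "n - 1"] n w by (cases "n - 1 \<le> length lam") (auto simp: Suc_le_eq)
  then have "length lam < length w" using n by simp
  moreover have "shift w = shift (QDV (length w) lam)"
    using assms(2) n QDV_Suc[of lam "length w"] calculation by simp
  ultimately show ?thesis using n inj_shift by blast
qed

text \<open>Increasing \<open>n\<close> by 1 is a shift, and going down never leaves the family
  \<open>QDV n lam\<close>. This allows the rest of the proof to work with vectors instead of
  partitions.\<close>

lemma class_of_partition_eq_dyck_class:
  assumes "is_partition lam" "length lam < n"
  shows "class_of_partition lam = dyck_class (QDV n lam)"
proof (intro equalityI subsetI)
  fix v assume "v \<in> dyck_class (QDV n lam)"
  then have "equivclp dyck_step (QDV n lam) v" by (simp add: dyck_class_def)
  then show "v \<in> class_of_partition lam"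
  proof (induction rule: equivclp_induct)
    case base
    then show ?case using assms by (auto simp: class_of_partition_def)
  next
    case (step y z)
    then obtain m where m: "y = QDV m lam" "length lam < m" by (auto simp: class_of_partition_def)
    from step.hyps(2) consider "z = shift y" | "y = shift z" "qdv z"
      by (auto simp: dyck_step_def)
    then show ?case
    proof cases
      case 1
      then have "z = QDV (Suc m) lam" using m by (simp add: QDV_Suc)
      then show ?thesis using m by (auto simp: class_of_partition_def)
    next
      case 2
      then show ?thesis using QDV_eq_shiftD[OF assms(1), of m z] m
        by (auto simp: class_of_partition_def)
    qed
  qed
next
  fix v assume "v \<in> class_of_partition lam"
  then obtain m where m: "v = QDV m lam" "length lam < m" by (auto simp: class_of_partition_def)
  have up: "equivclp dyck_step (QDV a lam) (QDV (a + i) lam)" if "length lam < a" for a i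
  proof (induction i)
    case (Suc i)
    have "dyck_step (QDV (a + i) lam) (QDV (a + Suc i) lam)"
      using that assms(1) by (simp add: dyck_step_def qdv_QDV QDV_Suc)
    then show ?case using Suc by (meson equivclp_into_equivclp)
  qed simp
  have "equivclp dyck_step (QDV n lam) (QDV m lam)"
    using up[OF assms(2), of "m - n"] up[OF m(2), of "n - m"]
    by (cases "n \<le> m") (auto intro: equivclp_sym)
  then show "v \<in> dyck_class (QDV n lam)"
    using m assms(1) by (simp add: dyck_class_def qdv_QDV)
qed

text \<open>The zeros of a decreasing list stand at its end, where \<open>part\<close> has the
  default value 0 anyway.\<close>

lemma part_filter_pos:
  assumes "sorted_wrt (\<ge>) xs"
  shows "part (filter (\<lambda>x. 0 < x) xs) i = part xs i"
  using assms
proof (induction xs arbitrary: i)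
  case (Cons x xs)
  show ?case
  proof (cases "0 < x")
    case True
    have *: "part (y # ys) i = (if i = 0 then 0 else if i = 1 then y else part ys (i - 1))" for y ys
      by (auto simp: part_def nth_Cons')
    show ?thesis using True Cons by (simp add: *)
  next
    case False
    then have z: "\<forall>y\<in>set (x # xs). y = 0" using Cons.prems by auto
    then have "filter (\<lambda>x. 0 < x) (x # xs) = []" by (auto simp: filter_empty_conv)
    then show ?thesis using z
      by (auto simp: part_def simp del: set_simps dest: nth_mem)
  qed
qed (simp add: part_def)

lemma is_partition_filter_pos: "sorted_wrt (\<ge>) xs \<Longrightarrow> is_partition (filter (\<lambda>x. 0 < x) xs)"
  by (simp add: is_partition_def sorted_wrt_filter)

text \<open>The parts are the numbers \<open>j - v ! j\<close>, read from right to left: they are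
  nonnegative because \<open>v ! j \<le> j\<close>, and decreasing by the growth condition.\<close>

lemma QDV_surj:
  assumes "qdv v"
  shows "\<exists>lam. is_partition lam \<and> length lam < length v \<and> QDV (length v) lam = v"
proof -
  define n where "n = length v"
  define f where "f = (\<lambda>j. nat (int j - v ! j))"
  define xs where "xs = map f (rev [0..<n])"
  have n: "0 < n" using assms by (auto simp: qdv_def n_def)
  have v0: "v ! 0 = 0" using assms by (simp add: qdv_def)
  have stp: "Suc i < n \<Longrightarrow> v ! Suc i \<le> v ! i + 1" for i using assms by (simp add: qdv_def n_def)
  have le: "v ! i \<le> int i" if "i < n" for i
    using that by (induction i) (use v0 stp in force)+
  have mono: "f i \<le> f j" if "i \<le> j" "j < n" for i j
    using that
  proof (induction j)
    case (Suc j)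
    have "f j \<le> f (Suc j)" using stp[of j] Suc.prems by (auto simp: f_def)
    then show ?case using Suc by (cases "i = Suc j") auto
  qed simp
  have nth: "xs ! i = f (n - Suc i)" if "i < n" for i
    using that by (simp add: xs_def rev_nth)
  have len: "length xs = n" by (simp add: xs_def)
  have srt: "sorted_wrt (\<ge>) xs"
    unfolding sorted_wrt_iff_nth_less by (auto simp: nth len intro: mono)
  define lam where "lam = filter (\<lambda>x. 0 < x) xs"
  \<comment> \<open>Position 0 contributes the value 0, so discarding zeros makes the list strictly
    shorter than \<open>n\<close>.\<close>
  have "\<exists>x\<in>set xs. \<not> 0 < x"
  proof -
    have "f 0 \<in> set xs" using n by (simp add: xs_def)
    moreover have "f 0 = 0" using v0 by (simp add: f_def)
    ultimately show ?thesis by force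
  qed
  then obtain x where "x \<in> set xs" "\<not> 0 < x" by blast
  then have "length lam < length xs"
    unfolding lam_def by (rule length_filter_less)
  then have "length lam < n" by (simp only: len)
  moreover have "is_partition lam" unfolding lam_def by (rule is_partition_filter_pos[OF srt])
  moreover have "QDV n lam = v"
  proof (rule nth_equalityI)
    fix i assume "i < length (QDV n lam)"
    then have i: "i < n" by simp
    have "part lam (n - i) = part xs (n - i)" unfolding lam_def by (rule part_filter_pos[OF srt])
    also have "\<dots> = f i" using i nth[of "n - i - 1"] by (simp add: part_def len Suc_le_eq)
    finally show "QDV n lam ! i = v ! i" using i le[OF i] by (simp add: QDV_nth f_def)
  qed (simp add: n_def)
  ultimately show ?thesis unfolding n_def by blast
qed

section \<open>The map \<open>NU1\<close> on vectors\<close>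

lemma NU1_QDV:
  assumes g: "is_partition \<gamma>" "part \<gamma> 1 \<le> length \<gamma> + 2"
    and g': "\<gamma>' = filter (\<lambda>x. 0 < x) ((length \<gamma> + 1) # map (\<lambda>x. x - 1) \<gamma>)"
    and u: "QDV (Suc (length \<gamma>)) \<gamma> = 0 # u"
  shows "class_of_partition \<gamma> = dyck_class (0 # u)"
    and "class_of_partition \<gamma>' = dyck_class (0 # incr u @ [0])"
    and "u = [] \<or> hd u \<le> 0" "- 2 \<le> last (0 # u)" "qdv (0 # u)"
proof -
  let ?l = "length \<gamma>" and ?xs = "(length \<gamma> + 1) # map (\<lambda>x. x - 1) \<gamma>"
  show "class_of_partition \<gamma> = dyck_class (0 # u)"
    using class_of_partition_eq_dyck_class[OF g(1), of "Suc ?l"] u by simp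
  show "qdv (0 # u)" using qdv_QDV[OF g(1), of "Suc ?l"] u by simp
  have lu: "length u = ?l" using arg_cong[OF u, of length] by simp
  have un: "u ! i = int (Suc i) - int (part \<gamma> (?l - i))" if "i < ?l" for i
    using QDV_nth[of "Suc i" "Suc ?l" \<gamma>] that u by simp
  \<comment> \<open>At this length the smallest part, which is at least 1, belongs to position
    1.\<close>
  show "u = [] \<or> hd u \<le> 0"
  proof (cases "?l = 0")
    case False
    then have "0 < part \<gamma> ?l" by (intro part_pos[OF g(1)]) (auto simp: Suc_le_eq)
    then have "u ! 0 \<le> 0" using un[of 0] False by simp
    then show ?thesis by (cases u) auto
  qed (use lu in simp)
  \<comment> \<open>The last entry is the number of parts minus the largest part, so the domain of
    \<open>NU1\<close> is described by a bound on the last letter.\<close>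
  show "- 2 \<le> last (0 # u)"
  proof (cases "?l = 0")
    case False
    then have "last (0 # u) = u ! (?l - 1)" using lu by (auto simp: last_conv_nth)
    also have "\<dots> = int ?l - int (part \<gamma> 1)" using un[of "?l - 1"] False by simp
    finally show ?thesis using g(2) by simp
  qed (use lu in simp)
  have srt\<gamma>: "sorted_wrt (\<ge>) \<gamma>" using g(1) by (simp add: is_partition_def)
  have le: "x \<le> ?l + 2" if "x \<in> set \<gamma>" for x
  proof (cases \<gamma>)
    case (Cons y ys)
    then have "y \<le> ?l + 2" using g(2) by (simp add: part_def)
    moreover have "x \<le> y" using that Cons srt\<gamma> by auto
    ultimately show ?thesis by simp
  qed (use that in simp)
  \<comment> \<open>By the domain condition the old largest part minus 1 is at most
    \<open>?l + 1\<close>, so the new part may stand first.\<close>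
  have srt: "sorted_wrt (\<ge>) ?xs"
  proof -
    have "sorted_wrt (\<lambda>x y. y - 1 \<le> x - 1) \<gamma>"
      by (rule sorted_wrt_mono_rel[OF _ srt\<gamma>]) auto
    then show ?thesis by (auto simp: sorted_wrt_map dest: le)
  qed
  have p': "part \<gamma>' i = part ?xs i" for i
    unfolding g' by (rule part_filter_pos[OF srt])
  have P: "is_partition \<gamma>'" unfolding g' by (rule is_partition_filter_pos[OF srt])
  have "length \<gamma>' \<le> length ?xs" unfolding g' by (rule length_filter_le)
  then have L: "length \<gamma>' < ?l + 2" by simp
  \<comment> \<open>Lowering a part by 1 raises its entry by 1, and the new part
    \<open>?l + 1\<close> at position \<open>?l + 1\<close> gives the final 0.\<close>
  have "QDV (?l + 2) \<gamma>' = 0 # incr u @ [0]"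
  proof (rule nth_equalityI)
    fix i assume "i < length (QDV (?l + 2) \<gamma>')"
    then have i: "i < ?l + 2" by simp
    have pt: "part \<gamma>' j = (if j = 0 \<or> j > Suc ?l then 0 else if j = 1 then ?l + 1 else part \<gamma> (j - 1) - 1)" for j
      unfolding p' by (auto simp: part_def nth_Cons')
    consider "i = 0" | "i = ?l + 1" | j where "i = Suc j" "j < ?l"
      using i by (cases i) (auto simp: less_Suc_eq)
    then show "QDV (?l + 2) \<gamma>' ! i = (0 # incr u @ [0]) ! i"
    proof cases
      case 1
      then show ?thesis using i by (simp add: QDV_nth pt)
    next
      case 2
      then show ?thesis using i lu by (simp add: QDV_nth pt nth_append)
    next
      case 3
      then have "0 < part \<gamma> (?l - j)" by (intro part_pos[OF g(1)]) (auto simp: Suc_le_eq)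
      moreover have "\<not> ?l < ?l - j" by simp
      ultimately show ?thesis using i lu 3 by (simp add: QDV_nth pt nth_append un Suc_diff_le of_nat_diff)
    qed
  qed (simp add: lu)
  then show "class_of_partition \<gamma>' = dyck_class (0 # incr u @ [0])"
    using class_of_partition_eq_dyck_class[OF P L] by simp
qed

text \<open>Read as an infinite word with all letters lowered by 1, \<open>0 # incr u @ [0]\<close>
  is \<open>u\<close> followed by -1: the 0 ending the initial run has been removed and -1
  appended.\<close>

lemma NU1_vec:
  "NU1 C D \<longleftrightarrow> (\<exists>u. qdv (0 # u) \<and> (u = [] \<or> hd u \<le> 0) \<and> - 2 \<le> last (0 # u) \<and>
     C = dyck_class (0 # u) \<and> D = dyck_class (0 # incr u @ [0]))"
proof
  assume "NU1 C D"
  then show "\<exists>u. qdv (0 # u) \<and> (u = [] \<or> hd u \<le> 0) \<and> - 2 \<le> last (0 # u) \<and>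
     C = dyck_class (0 # u) \<and> D = dyck_class (0 # incr u @ [0])"
  proof cases
    case (1 \<gamma>)
    obtain u where u: "QDV (Suc (length \<gamma>)) \<gamma> = 0 # u"
      using qdv_QDV[OF 1(3), of "Suc (length \<gamma>)"] by (cases "QDV (Suc (length \<gamma>)) \<gamma>") (auto simp: qdv_def)
    show ?thesis using NU1_QDV[OF 1(3,4) refl u] 1(1,2) by blast
  qed
next
  assume "\<exists>u. qdv (0 # u) \<and> (u = [] \<or> hd u \<le> 0) \<and> - 2 \<le> last (0 # u) \<and>
     C = dyck_class (0 # u) \<and> D = dyck_class (0 # incr u @ [0])"
  then obtain u where u: "qdv (0 # u)" "u = [] \<or> hd u \<le> 0" "- 2 \<le> last (0 # u)"
     "C = dyck_class (0 # u)" "D = dyck_class (0 # incr u @ [0])" by blast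
  obtain \<gamma> where g: "is_partition \<gamma>" "length \<gamma> < Suc (length u)" "QDV (Suc (length u)) \<gamma> = 0 # u"
    using QDV_surj[OF u(1)] by auto
  \<comment> \<open>An entry at most 0 at position 1 means that part number \<open>length u\<close>
    is nonzero, which fixes the number of parts.\<close>
  have len: "length \<gamma> = length u"
  proof (cases u)
    case (Cons x u')
    then have "x = 1 - int (part \<gamma> (length u))"
      using QDV_nth[of 1 "Suc (length u)" \<gamma>] g(3) by simp
    then have "part \<gamma> (length u) \<noteq> 0" using u(2) Cons by auto
    then have "length u \<le> length \<gamma>" using part_beyond not_le by metis
    then show ?thesis using g(2) by simp
  qed (use g in simp)
  have "part \<gamma> 1 \<le> length \<gamma> + 2"
  proof (cases "u = []")
    case True
    then show ?thesis using len by (simp add: part_def)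
  next
    case False
    then have "last (0 # u) = (0 # u) ! length u" by (simp add: last_conv_nth nth_Cons')
    also have "\<dots> = int (length u) - int (part \<gamma> 1)"
      unfolding g(3)[symmetric] by (subst QDV_nth) auto
    finally show ?thesis using u(3) len by simp
  qed
  then have b: "part \<gamma> 1 \<le> length \<gamma> + 2" .
  then have n1: "NU1 (class_of_partition \<gamma>)
         (class_of_partition (filter (\<lambda>x. 0 < x) ((length \<gamma> + 1) # map (\<lambda>x. x - 1) \<gamma>)))"
    by (rule NU1.intros[OF g(1)])
  show "NU1 C D"
    using NU1_QDV[OF g(1) b refl, of u] n1 g(3) len u by simp
qed

section \<open>Injectivity of \<open>NU\<close>\<close>

lemma replicate_append_same2: "replicate n x @ [x, x] = x # x # replicate n x"
  by (induction n) auto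

text \<open>The ending 01 or 11 of the reduced vector separates the image of \<open>NU2\<close> from
  the image of \<open>NU1\<close> and from the flagpole vectors.\<close>

lemma NU2_reduced:
  assumes "NU2 C D"
  shows "\<exists>w Y c. qdv w \<and> hd (tl w) = 0 \<and> w = Y @ [c, 1] \<and> c \<in> {0, 1} \<and> D = dyck_class w"
  using assms
proof cases
  case (rule_a h A)
  obtain m where m: "h = Suc (Suc m)" using le_Suc_ex[OF rule_a(3)] by auto
  let ?w = "[0] @ replicate (h - 1) 0 @ [1] @ A @ replicate h 1"
  have "qdv ?w" using rule_a(4) m
    by (auto simp: qdv_Cons slow_growth_append slow_growth_Cons replicate_append_same[symmetric] hd_append dest: hd_in_set)
  moreover have "hd (tl ?w) = 0" using m by auto
  moreover have "?w = ([0] @ replicate (h - 1) 0 @ [1] @ A @ replicate m 1) @ [1, 1]"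
    using m by (simp add: replicate_append_same2)
  ultimately show ?thesis using rule_a(2) by blast
next
  case (rule_b k B)
  obtain m where m: "k = Suc m" using le_Suc_ex[OF rule_b(3)] by auto
  let ?w = "[0] @ replicate k 0 @ B @ [0] @ replicate k 1"
  have "qdv ?w" using rule_b(4) m
    by (auto simp: qdv_Cons slow_growth_append slow_growth_Cons hd_append)
  moreover have "hd (tl ?w) = 0" using m by auto
  moreover have "\<exists>Y c. c \<in> {0, 1} \<and> ?w = Y @ [c, 1]"
  proof (cases m)
    case 0
    then have "?w = ([0] @ replicate k 0 @ B) @ [0, 1]" using m by simp
    then show ?thesis by blast
  next
    case (Suc n)
    then have "?w = ([0] @ replicate k 0 @ B @ [0] @ replicate n 1) @ [1, 1]"
      using m by (simp add: replicate_append_same2)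
    then show ?thesis by blast
  qed
  ultimately show ?thesis using rule_b(2) by blast
qed

text \<open>The vector produced by \<open>NU1\<close> ends in 0 and arises from the reduced one by
  shifts, each of which raises the last letter by 1.\<close>

lemma NU1_reduced_last:
  assumes 1: "NU1 C D" and w: "qdv w" "hd (tl w) \<noteq> 1" "D = dyck_class w"
  shows "last w \<le> 0"
proof -
  obtain u where u: "qdv (0 # u)" "u = [] \<or> hd u \<le> 0" "D = dyck_class (0 # incr u @ [0])" "- 2 \<le> last (0 # u)"
    using 1 NU1_vec by auto
  have "qdv (0 # incr u @ [0])"
    using u by (auto simp: qdv_Cons slow_growth_append slow_growth_Cons hd_append hd_map last_map)
  then obtain i where "0 # incr u @ [0] = (shift ^^ i) w"
    using dyck_class_reduced[of "0 # incr u @ [0]" w] u w by auto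
  then have "last (0 # incr u @ [0]) = last w + int i"
    using last_shift_pow[of w i] w by (simp add: qdv_def)
  then show ?thesis by simp
qed

lemma NU1_NU2_disjoint: "NU1 C D \<Longrightarrow> NU2 C' D \<Longrightarrow> False"
  using NU1_reduced_last NU2_reduced by fastforce

text \<open>Both vectors produced by \<open>NU1\<close> end in 0, so no shift separates them and
  they agree letter by letter.\<close>

lemma NU1_inj: "NU1 C D \<Longrightarrow> NU1 C' D \<Longrightarrow> C = C'"
proof -
  assume 1: "NU1 C D" and 2: "NU1 C' D"
  have q: "qdv (0 # incr u @ [0])" if "qdv (0 # u)" "u = [] \<or> hd u \<le> 0" "- 2 \<le> last (0 # u)" for u
    using that by (auto simp: qdv_Cons slow_growth_append slow_growth_Cons hd_append hd_map last_map)
  obtain u where u: "qdv (0 # u)" "C = dyck_class (0 # u)" "D = dyck_class (0 # incr u @ [0])"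
    "qdv (0 # incr u @ [0])"
    using 1 q NU1_vec by auto
  obtain t where t: "qdv (0 # t)" "C' = dyck_class (0 # t)" "D = dyck_class (0 # incr t @ [0])"
    "qdv (0 # incr t @ [0])"
    using 2 q NU1_vec by auto
  have "\<exists>i. 0 # incr t @ [0] = (shift ^^ i) (0 # incr u @ [0]) \<or> 0 # incr u @ [0] = (shift ^^ i) (0 # incr t @ [0])"
    using dyck_class_eqD[of "0 # incr u @ [0]" "0 # incr t @ [0]"] t u by simp
  then obtain i where i: "0 # incr t @ [0] = (shift ^^ i) (0 # incr u @ [0]) \<or> 0 # incr u @ [0] = (shift ^^ i) (0 # incr t @ [0])" ..
  have "last (0 # incr t @ [0]) = 0" "last (0 # incr u @ [0]) = 0" by simp_all
  moreover have "last ((shift ^^ i) (0 # incr u @ [0])) = int i" "last ((shift ^^ i) (0 # incr t @ [0])) = int i"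
    by (simp_all add: last_shift_pow)
  ultimately have "i = 0" using i by (metis of_nat_eq_0_iff)
  then have "shift t = shift u" using i by auto
  then have "t = u" by (rule inj_shift)
  then show ?thesis using t u by simp
qed

lemma replicate_append_eqD:
  assumes "replicate m a @ xs = replicate n a @ ys"
    and "xs \<noteq> []" "hd xs \<noteq> a" "ys \<noteq> []" "hd ys \<noteq> a"
  shows "m = n \<and> xs = ys"
  using assms
proof (induction m arbitrary: n)
  case 0
  then show ?case by (cases n) auto
next
  case (Suc m)
  then show ?case by (cases n) auto
qed

lemma append_replicate_eqD:
  assumes "xs @ replicate m a = ys @ replicate n a"
    and "xs \<noteq> []" "last xs \<noteq> a" "ys \<noteq> []" "last ys \<noteq> a"
  shows "m = n \<and> xs = ys"
proof -
  have "replicate m a @ rev xs = replicate n a @ rev ys"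
    using arg_cong[OF assms(1), of rev] by (simp only: rev_append rev_replicate)
  from replicate_append_eqD[OF this] show ?thesis using assms(2-) by (simp add: hd_rev)
qed

lemma replicate_append_leD:
  assumes "replicate m a @ xs = replicate n a @ ys" "ys \<noteq> []" "hd ys \<noteq> a"
  shows "m \<le> n"
  using assms
proof (induction m arbitrary: n)
  case (Suc m)
  then show ?case by (cases n) auto
qed simp

text \<open>The parameter can be read off the reduced image word: under rule (a) it starts with
  exactly \<open>h\<close> zeros, under rule (b) it ends with exactly \<open>k\<close> ones. The
  remaining letters are then \<open>A\<close> or \<open>B\<close>.\<close>

lemma NU2_inj: "NU2 C D \<Longrightarrow> NU2 C' D \<Longrightarrow> C = C'"
proof -
  assume 1: "NU2 C D" and 2: "NU2 C' D"
  \<comment> \<open>For a common image word, comparing initial zeros gives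
    \<open>k + 1 \<le> h\<close>, and comparing final ones gives \<open>h \<le> k\<close>.\<close>
  have ab: False if a: "2 \<le> h" "A = [] \<or> ((\<forall>x\<in>set A. x \<le> 2) \<and> 0 \<le> last A \<and> slow_growth A)"
     and b: "[0] @ replicate (h - 1) 0 @ [1] @ A @ replicate h 1 = [0] @ replicate k 0 @ B @ [0] @ replicate k 1"
   for h k :: nat and A B :: "int list"
  proof -
    have "replicate (Suc k) 0 @ (B @ [0] @ replicate k 1) = replicate h 0 @ ([1] @ A @ replicate h (1::int))"
      using b a by (cases h) auto
    then have "Suc k \<le> h" by (rule replicate_append_leD) auto
    moreover have "replicate h 1 @ rev ([0] @ replicate (h - 1) 0 @ [1] @ A) = replicate k 1 @ rev ([0] @ replicate k 0 @ B @ [0::int])"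
      using arg_cong[OF b, of rev] by simp
    then have "h \<le> k" by (rule replicate_append_leD) auto
    ultimately show False by simp
  qed
  have core: "C = C'" if
    "[0] @ replicate (h - 1) 0 @ [1] @ A @ replicate h 1 = [0] @ replicate (h' - 1) 0 @ [1] @ A' @ replicate h' 1"
    "C = dyck_class ([0, 1] @ replicate h 2 @ A @ replicate (h - 1) (- 1))"
    "C' = dyck_class ([0, 1] @ replicate h' 2 @ A' @ replicate (h' - 1) (- 1))" "2 \<le> h" "2 \<le> h'"
   for h h' :: nat and A A' :: "int list"
  proof -
    have "replicate (h - 1) 0 @ ([1] @ A @ replicate h 1) = replicate (h' - 1) 0 @ ([1] @ A' @ replicate h' (1::int))"
      using that(1) by simp
    then have *: "h - 1 = h' - 1 \<and> [1] @ A @ replicate h 1 = [1] @ A' @ replicate h' 1"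
      by (rule replicate_append_eqD) simp_all
    then have "h = h'" using that(4,5) by linarith
    moreover from this * have "A = A'" by simp
    ultimately show ?thesis using that(2,3) by (simp only:)
  qed
  have core2: "C = C'" if
    "[0] @ replicate k 0 @ B @ [0] @ replicate k 1 = [0] @ replicate k' 0 @ B' @ [0] @ replicate k' 1"
    "C = dyck_class ([0, 1] @ replicate k 2 @ B @ replicate k (- 1))"
    "C' = dyck_class ([0, 1] @ replicate k' 2 @ B' @ replicate k' (- 1))"
   for k k' :: nat and B B' :: "int list"
  proof -
    have "([0] @ replicate k 0 @ B @ [0]) @ replicate k 1 = ([0] @ replicate k' 0 @ B' @ [0]) @ replicate k' (1::int)"
      using that(1) by simp
    then have *: "k = k' \<and> [0] @ replicate k 0 @ B @ [0] = [0] @ replicate k' 0 @ B' @ [0]"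
      by (rule append_replicate_eqD) simp_all
    then have k: "k = k'" ..
    from conjunct2[OF *] have "B = B'" unfolding k by simp
    then show ?thesis unfolding that(2,3) k by (rule arg_cong)
  qed

  have qa: "qdv ([0] @ replicate (h - 1) 0 @ [1] @ A @ replicate h 1) \<and> hd (tl ([0] @ replicate (h - 1) 0 @ [1] @ A @ replicate h 1)) \<noteq> (1::int)"
    if c: "2 \<le> h" and "A = [] \<or> ((\<forall>x\<in>set A. x \<le> 2) \<and> 0 \<le> last A \<and> slow_growth A)" for h A
  proof -
    obtain m where m: "h = Suc (Suc m)" using le_Suc_ex[OF c] by auto
    then show ?thesis using that
      by (auto simp: qdv_Cons slow_growth_append slow_growth_Cons hd_append dest: hd_in_set)
  qed
  have qb: "qdv ([0] @ replicate k 0 @ B @ [0] @ replicate k 1) \<and> hd (tl ([0] @ replicate k 0 @ B @ [0] @ replicate k 1)) \<noteq> (1::int)"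
    if c: "1 \<le> k" and "B = [] \<or> ((\<forall>x\<in>set B. x \<le> 2) \<and> hd B \<le> 1 \<and> - 1 \<le> last B \<and> slow_growth B)" for k B
  proof -
    obtain m where m: "k = Suc m" using le_Suc_ex[OF c] by auto
    then show ?thesis using that
      by (auto simp: qdv_Cons slow_growth_append slow_growth_Cons hd_append)
  qed
  from 1 2 show ?thesis
  proof (cases rule: NU2.cases[case_product NU2.cases])
    case (rule_a_rule_a h A h' A')
    note r = this
    show ?thesis
      by (rule core[OF dyck_class_reduced_eq[OF trans[OF r(2)[symmetric] r(6)]] r(1,5,3,7)])
        (use qa r in blast)+
  next
    case (rule_a_rule_b h A k B)
    note r = this
    have False
      by (rule ab[OF r(3,4) dyck_class_reduced_eq[OF trans[OF r(2)[symmetric] r(6)]]])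
        (use qa qb r in blast)+
    then show ?thesis ..
  next
    case (rule_b_rule_a k B h A)
    note r = this
    have False
      by (rule ab[OF r(7,8) dyck_class_reduced_eq[OF trans[OF r(6)[symmetric] r(2)]]])
        (use qa qb r in blast)+
    then show ?thesis ..
  next
    case (rule_b_rule_b k B k' B')
    note r = this
    show ?thesis
      by (rule core2[OF dyck_class_reduced_eq[OF trans[OF r(2)[symmetric] r(6)]] r(1,5)])
        (use qb r in blast)+
  qed
qed

lemma NU_inj: "NU C D \<Longrightarrow> NU C' D \<Longrightarrow> C = C'"
  unfolding NU_def using NU1_inj NU2_inj NU1_NU2_disjoint by blast

section \<open>Ternary words\<close>

text \<open>When all letters have to be raised by 1, the word starts with 0, -1; excluding a 2 after
  a -1 keeps the raised letters at most 2.\<close>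

definition ternary :: "int list \<Rightarrow> bool" where
  "ternary w \<longleftrightarrow> qdv w \<and> set w \<subseteq> {-1, 0, 1, 2} \<and> sorted_wrt (\<lambda>x y. x = -1 \<longrightarrow> y \<noteq> 2) w"

section \<open>The deficit and its letter counts\<close>

definition nondinv :: "int \<Rightarrow> int list \<Rightarrow> int" where
  "nondinv x w = int (length (filter (\<lambda>y. x - y \<noteq> 0 \<and> x - y \<noteq> 1) w))"

text \<open>The statistic dinv counts pairs with difference 0 or 1. Counting the complementary pairs
  absorbs the term \<open>n(n - 1)/2\<close> of the deficit.\<close>

fun nondinv_pairs :: "int list \<Rightarrow> int" where
  "nondinv_pairs [] = 0"
| "nondinv_pairs (x # w) = nondinv x w + nondinv_pairs w"

definition num :: "int \<Rightarrow> int list \<Rightarrow> int" where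
  "num x w = int (count_list w x)"

text \<open>The deficit \<open>n(n - 1)/2 - area - dinv\<close>; each letter \<open>-1\<close> contributes 1 to \<open>dinv\<close> by pairing with
  the letter \<open>-1\<close> of the implicit infinite prefix. The formula is only meant for words with letters
  at least \<open>-1\<close>.\<close>

definition dfc :: "int list \<Rightarrow> int" where
  "dfc w = nondinv_pairs w - sum_list w - num (-1) w"

lemma num_simps [simp]:
  "num x [] = 0"
  "num x (y # w) = (if x = y then 1 else 0) + num x w"
  "num x (v @ w) = num x v + num x w"
  "num x (replicate n y) = (if x = y then int n else 0)"
  by (auto simp: num_def count_list_append) (induction n, auto)+

lemma num_nonneg: "0 \<le> num x w"
  by (simp add: num_def)

lemma nondinv_Nil [simp]: "nondinv x [] = 0"
  and nondinv_Cons: "nondinv x (y # w) = (if x - y = 0 \<or> x - y = 1 then 0 else 1) + nondinv x w"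
  and nondinv_append [simp]: "nondinv x (v @ w) = nondinv x v + nondinv x w"
  by (auto simp: nondinv_def)

lemma nondinv_replicate: "nondinv x (replicate n y) = (if x - y = 0 \<or> x - y = 1 then 0 else int n)"
  by (induction n) (auto simp: nondinv_Cons)

text \<open>Over four letters all these counts are linear in the multiplicities, so invariance of
  \<open>dfc\<close> under a step reduces to arithmetic.\<close>

lemma nondinv_letters:
  assumes "set w \<subseteq> {-1, 0, 1, 2}"
  shows "nondinv 0 w = num 1 w + num 2 w"
    "nondinv 1 w = num (-1) w + num 2 w"
    "nondinv 2 w = num (-1) w + num 0 w"
    "nondinv (-1) w = num 0 w + num 1 w + num 2 w"
    "int (length w) = num (-1) w + num 0 w + num 1 w + num 2 w"
    "sum_list w = num 1 w + 2 * num 2 w - num (-1) w"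
  using assms by (induction w) (auto simp: nondinv_Cons)

definition nondinv_to :: "int list \<Rightarrow> int \<Rightarrow> int" where
  "nondinv_to v y = (\<Sum>x\<leftarrow>v. nondinv x [y])"

definition cross_nondinv :: "int list \<Rightarrow> int list \<Rightarrow> int" where
  "cross_nondinv v w = (\<Sum>x\<leftarrow>v. nondinv x w)"

lemma nondinv_pairs_append:
  "nondinv_pairs (v @ w) = nondinv_pairs v + nondinv_pairs w + cross_nondinv v w"
  by (induction v) (auto simp: cross_nondinv_def)

lemma cross_nondinv_simps:
  "cross_nondinv v [] = 0"
  "cross_nondinv v (y # w) = nondinv_to v y + cross_nondinv v w"
  "cross_nondinv v (w @ w') = cross_nondinv v w + cross_nondinv v w'"
  "cross_nondinv v (replicate n y) = int n * nondinv_to v y"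
  "cross_nondinv (replicate n x) w = int n * nondinv x w"
  unfolding cross_nondinv_def nondinv_to_def
proof -
  show "(\<Sum>x\<leftarrow>v. nondinv x (replicate n y)) = int n * (\<Sum>x\<leftarrow>v. nondinv x [y])"
    by (induction v) (auto simp: nondinv_replicate nondinv_Cons algebra_simps)
  show "(\<Sum>x\<leftarrow>replicate n x. nondinv x w) = int n * nondinv x w"
    by (induction n) (auto simp: algebra_simps)
qed (induction v; auto simp: nondinv_Cons)+

lemma nondinv_to_replicate: "nondinv_to (replicate n x) y = int n * nondinv x [y]"
  unfolding nondinv_to_def by (induction n) (auto simp: algebra_simps)

lemma nondinv_to_letters:
  assumes "set w \<subseteq> {-1, 0, 1, 2}"
  shows "nondinv_to w 1 = num (-1) w + num 0 w"
    "nondinv_to w 0 = num (-1) w + num 2 w"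
    "nondinv_to w (-1) = num 1 w + num 2 w"
  using assms unfolding nondinv_to_def by (induction w) (auto simp: nondinv_Cons)

lemma sum_list_replicate_int: "sum_list (replicate n (x::int)) = int n * x"
  by (induction n) (auto simp: algebra_simps)

lemma nondinv_pairs_replicate [simp]: "nondinv_pairs (replicate n x) = 0"
  by (induction n) (auto simp: nondinv_replicate)

lemma nondinv_incr [simp]: "nondinv (x + 1) (incr w) = nondinv x w"
  by (induction w) (auto simp: nondinv_Cons)

lemma nondinv_pairs_incr [simp]: "nondinv_pairs (incr w) = nondinv_pairs w"
  by (induction w) auto

lemma num_incr [simp]: "num x (incr w) = num (x - 1) w"
  by (induction w) auto

lemmas dfc_simps = dfc_def nondinv_letters nondinv_to_letters nondinv_to_replicate cross_nondinv_simps
  nondinv_pairs_append nondinv_replicate nondinv_Cons sum_list_replicate_int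

lemma sorted_wrt_replicate: "P x x \<Longrightarrow> sorted_wrt P (replicate n x)"
  by (induction n) auto

text \<open>One less than the number of zeros after the next shift of the letters, if the letters before the
  first \<open>-1\<close> were decreased by 1 and moved to the end.\<close>

definition num_bottom :: "int list \<Rightarrow> int" where
  "num_bottom w = num 0 (takeWhile (\<lambda>x. x \<noteq> -1) w) + num (-1) w"

lemma num_bottom_Cons: "x \<noteq> -1 \<Longrightarrow> num_bottom (x # w) = (if x = 0 then 1 else 0) + num_bottom w"
  by (simp add: num_bottom_def)

lemma num_bottom_replicate: "x \<noteq> -1 \<Longrightarrow> num_bottom (replicate n x @ w) = (if x = 0 then int n else 0) + num_bottom w"
  by (induction n) (auto simp: num_bottom_Cons)

lemma num_bottom_append_le: "num_bottom v \<le> num_bottom (v @ w)"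
proof (induction v)
  case Nil
  then show ?case by (simp add: num_bottom_def num_nonneg)
next
  case (Cons x v)
  then show ?case
    by (cases "x = -1") (auto simp: num_bottom_Cons, simp add: num_bottom_def num_nonneg)
qed

lemma num_bottom_snoc: "num_bottom (w @ [-1]) = num_bottom w + 1"
  by (induction w) (auto simp: num_bottom_def)

lemma num_bottom_append_minus: "num_bottom (w @ replicate n (-1)) = num_bottom w + int n"
proof (induction n)
  case (Suc n)
  have "w @ replicate (Suc n) (-1) = (w @ replicate n (-1)) @ [-1]"
    by (simp add: replicate_append_same)
  then show ?case using Suc num_bottom_snoc[of "w @ replicate n (-1)"] by (simp del: append_assoc)
qed simp

lemma num_bottom_nonneg_letters: "-1 \<notin> set w \<Longrightarrow> num_bottom w = num 0 w"
  by (induction w) (auto simp: num_bottom_Cons num_bottom_def)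

subsection \<open>One step of \<open>NU\<close> on ternary words\<close>

lemma NU1_class:
  "qdv (0 # u) \<Longrightarrow> u = [] \<or> hd u \<le> 0 \<Longrightarrow> - 2 \<le> last (0 # u) \<Longrightarrow>
    NU (dyck_class (0 # u)) (dyck_class (0 # incr u @ [0]))"
  unfolding NU_def NU1_vec by blast

lemma incr_decr: "incr (map (\<lambda>x. x - 1) w) = w"
  by (induction w) auto

text \<open>Undoing one shift turns the initial run 0, 1 into the single letter 0. Each further
  letter of the run raises the lower bound on the last letter by 1: it is -2, -1 and 0 for the runs
  0, 01 and 012.\<close>

lemma NU1_class_01:
  assumes "qdv (0 # 1 # x)" "x = [] \<or> hd x \<le> 1" "- 1 \<le> last (0 # 1 # x)"
  shows "NU (dyck_class (0 # 1 # x)) (dyck_class (0 # x @ [0]))"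
proof -
  let ?u = "map (\<lambda>x. x - 1) x"
  have s: "slow_growth ?u"
    using assms(1) slow_growth_incr[of ?u] unfolding incr_decr by (auto simp: qdv_Cons slow_growth_Cons)
  have "qdv (0 # ?u)" using assms(2) s by (cases x) (auto simp: qdv_Cons)
  moreover have "- 2 \<le> last (0 # ?u)" using assms(3) by (cases x) (auto simp: last_map)
  moreover have "?u = [] \<or> hd ?u \<le> 0" using assms(2) by (cases x) auto
  ultimately have "NU (dyck_class (0 # ?u)) (dyck_class (0 # incr ?u @ [0]))" by (intro NU1_class)
  moreover have "dyck_class (0 # 1 # x) = dyck_class (0 # ?u)"
    using dyck_class_shift[OF \<open>qdv (0 # ?u)\<close>] by (simp add: incr_decr del: map_map)
  ultimately show ?thesis by (simp only: incr_decr)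
qed

lemma NU1_class_012:
  assumes "qdv (0 # 1 # 2 # x)" "x = [] \<or> hd x \<le> 2" "0 \<le> last (0 # 1 # 2 # x)"
  shows "NU (dyck_class (0 # 1 # 2 # x)) (dyck_class (0 # 1 # x @ [1]))"
proof -
  let ?u = "map (\<lambda>x. x - 1) x"
  have s: "slow_growth ?u"
    using assms(1) slow_growth_incr[of ?u] unfolding incr_decr by (auto simp: qdv_Cons slow_growth_Cons)
  have q: "qdv (0 # 1 # ?u)" using assms(2) s by (cases x) (auto simp: qdv_Cons slow_growth_Cons)
  moreover have "- 1 \<le> last (0 # 1 # ?u)" using assms(3) by (cases x) (auto simp: last_map)
  moreover have "?u = [] \<or> hd ?u \<le> 1" using assms(2) by (cases x) auto
  ultimately have "NU (dyck_class (0 # 1 # ?u)) (dyck_class (0 # ?u @ [0]))" by (intro NU1_class_01)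
  moreover have "dyck_class (0 # 1 # 2 # x) = dyck_class (0 # 1 # ?u)"
    using dyck_class_shift[OF q] by (simp add: incr_decr del: map_map)
  moreover have "qdv (0 # ?u @ [0])" using q s assms(2,3)
    by (cases "x = []") (auto simp: qdv_Cons slow_growth_append slow_growth_Cons last_map hd_map hd_append)
  then have "dyck_class (0 # 1 # x @ [1]) = dyck_class (0 # ?u @ [0])"
    using dyck_class_shift by (fastforce simp: incr_decr simp del: map_map)
  ultimately show ?thesis by simp
qed

text \<open>The run is the single 0 and another 0 follows, so the rest is again a vector; the output
  of \<open>NU1_class\<close> is one shift above \<open>u @ [-1]\<close>.\<close>

lemma ternary_A0:
  assumes "ternary (0 # u)" "u \<noteq> []" "hd u = 0"
  shows "NU (dyck_class (0 # u)) (dyck_class (u @ [-1])) \<and> ternary (u @ [-1]) \<and>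
     dfc (u @ [-1]) = dfc (0 # u) \<and> num_bottom (u @ [-1]) = num_bottom (0 # u) \<and>
     sum_list (u @ [-1]) = sum_list (0 # u) - 1 \<and> length (u @ [-1]) = length (0 # u)"
proof -
  have t: "qdv (0 # u)" "set u \<subseteq> {-1, 0, 1, 2}" "sorted_wrt (\<lambda>x y. x = -1 \<longrightarrow> y \<noteq> 2) u"
    using assms(1) by (auto simp: ternary_def)
  have l: "last u \<in> {-1, 0, 1, 2}" using t(2) assms(2) last_in_set by blast
  then have "NU (dyck_class (0 # u)) (dyck_class (0 # incr u @ [0]))"
    using t(1) assms(2,3) by (intro NU1_class) auto
  moreover have q: "qdv (u @ [-1])"
    using t(1) l assms(2,3) by (auto simp: qdv_iff slow_growth_append slow_growth_Cons)
  moreover have "dyck_class (u @ [-1]) = dyck_class (0 # incr u @ [0])"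
    using dyck_class_shift[OF q] by simp
  moreover have "ternary (u @ [-1])"
    using q t by (auto simp: ternary_def sorted_wrt_append)
  moreover have "dfc (u @ [-1]) = dfc (0 # u)"
    using t(2) by (simp add: dfc_simps)
  ultimately show ?thesis by (simp add: num_bottom_snoc num_bottom_Cons)
qed

text \<open>Without its run letter the word would start with -1, so all letters are raised and the
  word becomes longer by one letter. The gain of 1 in \<open>num_bottom\<close> drives the
  termination argument.\<close>

lemma ternary_A1:
  assumes "ternary (0 # u)" "u = [] \<or> hd u = -1"
  shows "NU (dyck_class (0 # u)) (dyck_class (0 # incr u @ [0])) \<and> ternary (0 # incr u @ [0]) \<and>
     dfc (0 # incr u @ [0]) = dfc (0 # u) \<and> num_bottom (0 # incr u @ [0]) = num_bottom (0 # u) + 1 \<and>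
     set (incr u) \<subseteq> {0, 1, 2}"
proof -
  have t: "qdv (0 # u)" "set u \<subseteq> {-1, 0, 1, 2}" "sorted_wrt (\<lambda>x y. x = -1 \<longrightarrow> y \<noteq> 2) u"
    using assms(1) by (auto simp: ternary_def)
  have u2: "set u \<subseteq> {-1, 0, 1}" using assms(2) t(2,3) by (cases u) auto
  then have l: "u = [] \<or> last u \<in> {-1, 0, 1}" using last_in_set by blast
  have "NU (dyck_class (0 # u)) (dyck_class (0 # incr u @ [0]))"
    using t(1) l assms(2) by (intro NU1_class) auto
  moreover have q: "qdv (0 # incr u @ [0])"
    using t(1) l assms(2) by (auto simp: qdv_Cons slow_growth_append slow_growth_Cons hd_append hd_map last_map)
  moreover have i: "set (incr u) \<subseteq> {0, 1, 2}" using u2 by auto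
  moreover have i': "set (incr u) \<subseteq> {-1, 0, 1, 2}" using i by auto
  moreover have "ternary (0 # incr u @ [0])"
  proof -
    have "sorted_wrt (\<lambda>x y. x = -1 \<longrightarrow> y \<noteq> 2) (0 # incr u @ [0])"
      using i by (induction u) (auto simp: sorted_wrt_append)
    then show ?thesis using q i' by (auto simp: ternary_def)
  qed
  moreover have "dfc (0 # incr u @ [0]) = dfc (0 # u)"
  proof -
    \<comment> \<open>The letter -2 enters because \<open>num (-1)\<close> of the raised word counts
      the letters -2 of \<open>u\<close>.\<close>
    have n2: "num 2 u = 0" "num (-2) u = 0" using u2 by (auto simp: num_def count_list_0_iff)
    show ?thesis
      using t(2) i' n2 nondinv_letters(5)[OF t(2)]
      by (simp add: dfc_simps)
  qed
  moreover have "num_bottom (0 # incr u @ [0]) = num_bottom (0 # u) + 1"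
  proof -
    have "num_bottom (0 # incr u @ [0]) = num 0 (0 # incr u @ [0])"
      by (rule num_bottom_nonneg_letters) (use i in auto)
    moreover have "num_bottom (0 # u) = 1 + num (-1) u"
      using assms(2) by (cases u) (auto simp: num_bottom_def)
    ultimately show ?thesis by simp
  qed
  ultimately show ?thesis by blast
qed

lemma ternary_B:
  assumes "ternary (0 # 1 # x)" "x = [] \<or> hd x \<le> 1"
  shows "NU (dyck_class (0 # 1 # x)) (dyck_class (0 # x @ [0])) \<and> ternary (0 # x @ [0]) \<and>
     dfc (0 # x @ [0]) = dfc (0 # 1 # x) \<and> num_bottom (0 # x @ [0]) \<ge> num_bottom (0 # 1 # x) \<and>
     sum_list (0 # x @ [0]) = sum_list (0 # 1 # x) - 1 \<and> length (0 # x @ [0]) = length (0 # 1 # x)"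
proof -
  have t: "qdv (0 # 1 # x)" "set x \<subseteq> {-1, 0, 1, 2}" "sorted_wrt (\<lambda>x y. x = -1 \<longrightarrow> y \<noteq> 2) x"
    using assms(1) by (auto simp: ternary_def)
  have l: "x = [] \<or> last x \<in> {-1, 0, 1, 2}" using t(2) last_in_set by blast
  then have "NU (dyck_class (0 # 1 # x)) (dyck_class (0 # x @ [0]))"
    using t(1) assms(2) by (intro NU1_class_01) auto
  moreover have q: "qdv (0 # x @ [0])"
    using t(1) l assms(2) by (cases "x = []") (auto simp: qdv_Cons slow_growth_append slow_growth_Cons)
  moreover have "ternary (0 # x @ [0])"
    using q t by (auto simp: ternary_def sorted_wrt_append)
  moreover have "dfc (0 # x @ [0]) = dfc (0 # 1 # x)"
    using t(2) by (simp add: dfc_simps)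
  ultimately show ?thesis using num_bottom_append_le[of x "[0]"] by (simp add: num_bottom_Cons)
qed

lemma ternary_C:
  assumes "ternary (0 # 1 # 2 # x)" "0 \<le> last (2 # x)"
  shows "NU (dyck_class (0 # 1 # 2 # x)) (dyck_class (0 # 1 # x @ [1])) \<and> ternary (0 # 1 # x @ [1]) \<and>
     dfc (0 # 1 # x @ [1]) = dfc (0 # 1 # 2 # x) \<and> num_bottom (0 # 1 # x @ [1]) \<ge> num_bottom (0 # 1 # 2 # x) \<and>
     sum_list (0 # 1 # x @ [1]) = sum_list (0 # 1 # 2 # x) - 1 \<and> length (0 # 1 # x @ [1]) = length (0 # 1 # 2 # x)"
proof -
  have t: "qdv (0 # 1 # 2 # x)" "set x \<subseteq> {-1, 0, 1, 2}" "sorted_wrt (\<lambda>x y. x = -1 \<longrightarrow> y \<noteq> 2) x"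
    using assms(1) by (auto simp: ternary_def)
  have h: "x = [] \<or> hd x \<le> 2" using t(2) by (cases x) auto
  have "NU (dyck_class (0 # 1 # 2 # x)) (dyck_class (0 # 1 # x @ [1]))"
    using t(1) h assms(2) by (intro NU1_class_012) auto
  moreover have q: "qdv (0 # 1 # x @ [1])"
    using t(1) h assms(2) by (cases "x = []") (auto simp: qdv_Cons slow_growth_append slow_growth_Cons)
  moreover have "ternary (0 # 1 # x @ [1])"
    using q t by (auto simp: ternary_def sorted_wrt_append)
  moreover have "dfc (0 # 1 # x @ [1]) = dfc (0 # 1 # 2 # x)"
    using t(2) by (simp add: dfc_simps)
  ultimately show ?thesis using num_bottom_append_le[of x "[1]"] by (simp add: num_bottom_Cons)
qed

text \<open>Only whole runs around \<open>A\<close> are exchanged. Their interaction with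
  \<open>A\<close> depends on the multiplicities of its letters alone, which is why the deficit can
  be compared without knowing their order.\<close>

lemma ternary_a:
  assumes "ternary ([0, 1] @ replicate h 2 @ A @ replicate (h - 1) (-1))" "2 \<le> h" "A = [] \<or> 0 \<le> last A"
  defines "w \<equiv> [0, 1] @ replicate h 2 @ A @ replicate (h - 1) (-1)"
  defines "w' \<equiv> [0] @ replicate (h - 1) 0 @ [1] @ A @ replicate h 1"
  shows "NU (dyck_class w) (dyck_class w') \<and> ternary w' \<and>
     dfc w' = dfc w \<and> num_bottom w' \<ge> num_bottom w \<and>
     sum_list w' = sum_list w - 1 \<and> length w' = length w"
proof -
  have t: "qdv w" "set A \<subseteq> {-1, 0, 1, 2}" "sorted_wrt (\<lambda>x y. x = -1 \<longrightarrow> y \<noteq> 2) A"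
    using assms(1) by (auto simp: ternary_def sorted_wrt_append sorted_wrt_replicate w_def w'_def)
  obtain m where m: "h = Suc (Suc m)" using le_Suc_ex[OF assms(2)] by auto
  have s: "slow_growth A" using t(1) by (auto simp: w_def qdv_Cons slow_growth_Cons slow_growth_append)
  have A: "A = [] \<or> ((\<forall>x\<in>set A. x \<le> 2) \<and> 0 \<le> last A \<and> slow_growth A)"
    using s t(2) assms(3) by auto
  have h: "A = [] \<or> hd A \<le> 2" using t(2) by (cases A) auto
  have "NU (dyck_class w) (dyck_class w')"
    unfolding NU_def w_def w'_def using NU2.rule_a[OF assms(2) A] by blast
  moreover have q: "qdv w'"
    using s h assms(3) m by (auto simp: w'_def qdv_Cons slow_growth_Cons slow_growth_append hd_append)
  moreover have "ternary w'"
    using q t(2,3) m by (auto simp: ternary_def sorted_wrt_append sorted_wrt_replicate w_def w'_def)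
  moreover have "dfc w' = dfc w"
    using t(2) m by (simp add: dfc_simps w_def w'_def algebra_simps)
  moreover have "num_bottom w' \<ge> num_bottom w"
    using num_bottom_append_le[of A "replicate h 1"] m
    by (simp add: w_def w'_def num_bottom_Cons num_bottom_replicate num_bottom_append_minus[of A "Suc m", simplified])
  ultimately show ?thesis using m by (simp add: w_def w'_def sum_list_replicate_int)
qed

lemma ternary_b:
  assumes "ternary ([0, 1] @ replicate k 2 @ B @ replicate k (-1))" "1 \<le> k" "B = [] \<or> hd B \<le> 1"
  defines "w \<equiv> [0, 1] @ replicate k 2 @ B @ replicate k (-1)"
  defines "w' \<equiv> [0] @ replicate k 0 @ B @ [0] @ replicate k 1"
  shows "NU (dyck_class w) (dyck_class w') \<and> ternary w' \<and>
     dfc w' = dfc w \<and> num_bottom w' \<ge> num_bottom w \<and>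
     sum_list w' = sum_list w - 1 \<and> length w' = length w"
proof -
  have t: "qdv w" "set B \<subseteq> {-1, 0, 1, 2}" "sorted_wrt (\<lambda>x y. x = -1 \<longrightarrow> y \<noteq> 2) B"
    using assms(1) by (auto simp: ternary_def sorted_wrt_append sorted_wrt_replicate w_def w'_def)
  obtain m where m: "k = Suc m" using le_Suc_ex[OF assms(2)] by auto
  have s: "slow_growth B" using t(1) by (auto simp: w_def qdv_Cons slow_growth_Cons slow_growth_append)
  have "B = [] \<or> last B \<in> {-1, 0, 1, 2}" using t(2) last_in_set by blast
  then have l: "B = [] \<or> - 1 \<le> last B" by auto
  have B: "B = [] \<or> ((\<forall>x\<in>set B. x \<le> 2) \<and> hd B \<le> 1 \<and> - 1 \<le> last B \<and> slow_growth B)"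
    using s t(2) l assms(3) by auto
  have "NU (dyck_class w) (dyck_class w')"
    unfolding NU_def w_def w'_def using NU2.rule_b[OF assms(2) B] by blast
  moreover have q: "qdv w'"
    using s l assms(3) m by (auto simp: w'_def qdv_Cons slow_growth_Cons slow_growth_append hd_append)
  moreover have "ternary w'"
    using q t(2,3) m by (auto simp: ternary_def sorted_wrt_append sorted_wrt_replicate w_def w'_def)
  moreover have "dfc w' = dfc w"
    using t(2) m by (simp add: dfc_simps w_def w'_def algebra_simps)
  moreover have "num_bottom w' \<ge> num_bottom w"
    using num_bottom_append_le[of B "[0] @ replicate k 1"] m
    by (simp add: w_def w'_def num_bottom_Cons num_bottom_replicate num_bottom_append_minus[of B "Suc m", simplified])
  ultimately show ?thesis using m by (simp add: w_def w'_def sum_list_replicate_int)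
qed

lemma replicate_prefix: "\<exists>n r. xs = replicate n a @ r \<and> (r = [] \<or> hd r \<noteq> a)"
proof (induction xs)
  case (Cons x xs)
  then obtain n r where *: "xs = replicate n a @ r" "r = [] \<or> hd r \<noteq> a" by blast
  show ?case
  proof (cases "x = a")
    case True
    then have "x # xs = replicate (Suc n) a @ r" using * by simp
    then show ?thesis using * by blast
  next
    case False
    then have "x # xs = replicate 0 a @ (x # xs) \<and> hd (x # xs) \<noteq> a" by simp
    then show ?thesis by blast
  qed
qed simp

lemma replicate_suffix: "\<exists>n r. xs = r @ replicate n a \<and> (r = [] \<or> last r \<noteq> a)"
proof -
  obtain n r where "rev xs = replicate n a @ r" "r = [] \<or> hd r \<noteq> a"
    using replicate_prefix[of "rev xs" a] by blast
  then have "xs = rev r @ replicate n a" "rev r = [] \<or> last (rev r) \<noteq> a"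
    by (simp_all add: rev_swap last_rev)
  then show ?thesis by blast
qed

lemma set_replicate_subsetI [simp]: "x \<in> A \<Longrightarrow> set (replicate n x) \<subseteq> A"
  by (auto simp: set_replicate_conv_if)

text \<open>The cases are the initial runs 0, 01 and 012. \<open>NU1\<close> is blocked only for the
  run 012 with last letter -1, and there one of the rules of \<open>NU2\<close> fits.\<close>

lemma ternary_step:
  assumes w: "ternary w" "tl w \<noteq> []" "hd (tl w) \<noteq> -1"
  shows "\<exists>w'. NU (dyck_class w) (dyck_class w') \<and> ternary w' \<and> dfc w' = dfc w \<and>
     num_bottom w' \<ge> num_bottom w \<and> sum_list w' = sum_list w - 1 \<and> length w' = length w"
proof -
  obtain u where u: "w = 0 # u" "u \<noteq> []"
    using w by (cases w) (auto simp: ternary_def qdv_Cons)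
  have "hd u \<in> {-1, 0, 1, 2}" "hd u \<le> 1"
    using w(1) u by (auto simp: ternary_def qdv_Cons dest: hd_in_set)
  then consider "hd u = 0" | "hd u = 1" using w(3) u by auto
  then show ?thesis
  proof cases
    case 1
    show ?thesis using ternary_A0[of u] 1 u w(1) by (intro exI[of _ "u @ [-1]"]) simp
  next
    case 2
    then obtain x where x: "u = 1 # x" using u by (cases u) auto
    show ?thesis
    proof (cases "x = [] \<or> hd x \<le> 1")
      case True
      show ?thesis using ternary_B[OF _ True] w(1) u x by blast
    next
      case False
      moreover have "hd x \<le> 2" if "x \<noteq> []"
        using w(1) u x that by (auto simp: ternary_def qdv_Cons slow_growth_Cons)
      ultimately obtain y where y: "x = 2 # y" by (cases x) auto
      show ?thesis
      proof (cases "0 \<le> last (2 # y)")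
        case True
        show ?thesis using ternary_C[OF _ True] w(1) u x y by blast
      next
        case False
        have "last (2 # y) \<in> set (2 # y)" by (rule last_in_set) simp
        then have l: "last x = -1" using w(1) u x y False by (auto simp: ternary_def)
        \<comment> \<open>The run of 2s and the final run of -1s are taken maximal; comparing their
          lengths \<open>h\<close> and \<open>m\<close> selects the rule.\<close>
        obtain h r1 where r1: "x = replicate h 2 @ r1" "r1 = [] \<or> hd r1 \<noteq> 2"
          using replicate_prefix[of x 2] by blast
        obtain m r where r: "r1 = r @ replicate m (-1)" "r = [] \<or> last r \<noteq> -1"
          using replicate_suffix[of r1 "-1"] by blast
        have "r1 \<noteq> []"
        proof
          assume "r1 = []"
          then have "set x \<subseteq> {2}" using r1(1) by auto
          moreover have "-1 \<in> set x" unfolding l[symmetric] by (rule last_in_set) (simp add: y)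
          ultimately show False by auto
        qed
        have h: "1 \<le> h" using r1 y by (cases h) auto
        have m: "1 \<le> m"
          using l r1 r \<open>r1 \<noteq> []\<close> by (cases m) auto
        have hr: "r = [] \<or> hd r \<noteq> 2" using r1 r by auto
        have lets: "set r \<subseteq> {-1, 0, 1, 2}"
          using w(1) u x r1 r by (auto simp: ternary_def)
        have weq: "w = [0, 1] @ replicate h 2 @ r @ replicate m (-1)"
          using u x r1 r by simp
        show ?thesis
        proof (cases "m < h")
          case True
          \<comment> \<open>Rule (a) needs one more 2 than there are -1s, so its parameter is
            \<open>Suc m\<close>; the surplus 2s go to the front of \<open>A\<close>.\<close>
          then obtain j where j: "h = Suc m + j" using less_iff_Suc_add by auto
          let ?A = "replicate j 2 @ r"
          have weq': "w = [0, 1] @ replicate (Suc m) 2 @ ?A @ replicate (Suc m - 1) (-1)"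
            using weq by (simp add: j replicate_add)
          have lA: "?A = [] \<or> 0 \<le> last ?A"
          proof (cases "r = []")
            case False
            then have "last r \<in> {-1, 0, 1, 2}" using lets last_in_set by blast
            then show ?thesis using r False by auto
          qed (cases j, auto simp: last_replicate)
          have "2 \<le> Suc m" using m by simp
          show ?thesis
            unfolding weq' by (rule exI, rule ternary_a[OF w(1)[unfolded weq'] \<open>2 \<le> Suc m\<close> lA])
        next
          case False
          \<comment> \<open>Rule (b) uses equally many 2s and -1s, so its parameter is
            \<open>h\<close>; the surplus -1s go to the end of \<open>B\<close>.\<close>
          then obtain j where j: "m = j + h" using le_Suc_ex[of h m] by (auto simp: add.commute)
          let ?B = "r @ replicate j (-1)"
          have weq': "w = [0, 1] @ replicate h 2 @ ?B @ replicate h (-1)"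
            using weq by (simp add: j replicate_add)
          have lB: "?B = [] \<or> hd ?B \<le> 1"
          proof (cases "r = []")
            case False
            then have "hd r \<in> {-1, 0, 1, 2}" using lets hd_in_set by blast
            then show ?thesis using hr False by auto
          qed (cases j, auto)
          show ?thesis
            unfolding weq' by (rule exI, rule ternary_b[OF w(1)[unfolded weq'] h lB])
        qed
      qed
    qed
  qed
qed

section \<open>Termination of the orbit at a binary word\<close>

lemma nondinv_pairs_ge:
  "set u \<subseteq> {0, 1, 2} \<Longrightarrow> num 0 u * num 2 u \<le> nondinv_pairs u"
proof (induction u)
  case (Cons x u)
  then have u: "set u \<subseteq> {-1, 0, 1, 2}" and IH: "num 0 u * num 2 u \<le> nondinv_pairs u"
    and x: "x \<in> {0, 1, 2}" by auto
  show ?case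
    using x IH num_nonneg[of "-1" u] num_nonneg[of 1 u] num_nonneg[of 2 u] num_nonneg[of 0 u]
    by (auto simp: nondinv_letters[OF u] algebra_simps)
qed simp

text \<open>A 0 and a 2 differ by 2 in either order, so no such pair counts for dinv and the deficit
  is at least \<open>(num 0 t - 1) * num 2 t\<close>. As long as a 2 is left, the number of zeros is
  thus bounded.\<close>

lemma dfc_ge_num_bottom:
  assumes "set t \<subseteq> {0, 1, 2}" "num 0 t \<ge> 1" "num 2 t \<ge> 1"
  shows "num_bottom (0 # t) - 2 \<le> dfc (0 # t)"
proof -
  have t: "set t \<subseteq> {-1, 0, 1, 2}" and m: "num (-1) t = 0"
    using assms(1) by (auto simp: num_def count_list_0_iff)
  have "num_bottom (0 # t) = 1 + num 0 t"
    using assms(1) by (subst num_bottom_nonneg_letters) auto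
  moreover have "dfc (0 # t) = nondinv_pairs t - num 2 t"
    using m by (simp add: dfc_def nondinv_letters[OF t])
  moreover have "num 0 t - 1 \<le> (num 0 t - 1) * num 2 t"
    using assms(2,3) mult_left_mono[of 1 "num 2 t" "num 0 t - 1"] by simp
  ultimately show ?thesis
    using nondinv_pairs_ge[OF assms(1)] by (simp add: algebra_simps)
qed

lemma ternary_sum_length_nonneg: "ternary w \<Longrightarrow> 0 \<le> sum_list w + int (length w)"
proof -
  assume "ternary w"
  then have "set w \<subseteq> {-1, 0, 1, 2}" by (simp add: ternary_def)
  then show ?thesis by (induction w) auto
qed

text \<open>Lexicographic descent. Steps of fixed length lower the letter sum and never lower
  \<open>num_bottom\<close>; steps raising all letters increase \<open>num_bottom\<close>, which is
  at most the deficit plus 2 while a 2 remains. Once no 2 remains after such a step, the word is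
  binary.\<close>

lemma reaches_binary:
  assumes "ternary w"
  shows "\<exists>b. NU\<^sup>*\<^sup>* (dyck_class w) (dyck_class b) \<and> dfc b = dfc w \<and> qdv b \<and> set b \<subseteq> {0, 1}"
  using assms
proof (induction w rule: wf_induct[OF wf_measures[of
    "[\<lambda>w. nat (dfc w + 3 - num_bottom w), \<lambda>w. nat (sum_list w + int (length w))]"]])
  case (1 w)
  have IH: "\<exists>b. NU\<^sup>*\<^sup>* (dyck_class w) (dyck_class b) \<and> dfc b = dfc w \<and> qdv b \<and> set b \<subseteq> {0, 1}"
    if c: "NU (dyck_class w) (dyck_class v)" "ternary v" "dfc v = dfc w"
      "(v, w) \<in> measures [\<lambda>w. nat (dfc w + 3 - num_bottom w), \<lambda>w. nat (sum_list w + int (length w))]" for v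
  proof -
    obtain b where "NU\<^sup>*\<^sup>* (dyck_class v) (dyck_class b)" "dfc b = dfc v" "qdv b" "set b \<subseteq> {0, 1}"
      using 1(1) c(2,4) by blast
    then show ?thesis using c(1,3) by (metis converse_rtranclp_into_rtranclp)
  qed
  show ?case
  proof (cases "tl w = [] \<or> hd (tl w) = -1")
    case False
    then obtain v where v: "NU (dyck_class w) (dyck_class v)" "ternary v" "dfc v = dfc w"
     "num_bottom v \<ge> num_bottom w" "sum_list v = sum_list w - 1" "length v = length w"
      using ternary_step[OF 1(2)] by blast
    have "(v, w) \<in> measures [\<lambda>w. nat (dfc w + 3 - num_bottom w), \<lambda>w. nat (sum_list w + int (length w))]"
      using v ternary_sum_length_nonneg[OF v(2)] by auto
    then show ?thesis using IH v by blast
  next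
    case True
    obtain u where u: "w = 0 # u" using 1(2) by (cases w) (auto simp: ternary_def qdv_iff)
    let ?t = "incr u @ [0]"
    have v: "NU (dyck_class w) (dyck_class (0 # ?t))" "ternary (0 # ?t)" "dfc (0 # ?t) = dfc w"
      "num_bottom (0 # ?t) = num_bottom w + 1" "set (incr u) \<subseteq> {0, 1, 2}"
      using ternary_A1[of u] 1(2) True u by auto
    have t: "set ?t \<subseteq> {0, 1, 2}" using v(5) by auto
    show ?thesis
    proof (cases "num 2 ?t \<ge> 1")
      case True
      have "num_bottom (0 # ?t) - 2 \<le> dfc (0 # ?t)"
        by (rule dfc_ge_num_bottom[OF t]) (use True num_nonneg in auto)
      then show ?thesis using v by (intro IH[of "0 # ?t"]) auto
    next
      case False
      then have "num 2 ?t = 0" using num_nonneg[of 2 ?t] by linarith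
      then have "2 \<notin> set ?t" by (auto simp: num_def count_list_0_iff)
      then have "set (0 # ?t) \<subseteq> {0, 1}" using t by auto
      then show ?thesis using v by (intro exI[of _ "0 # ?t"]) (auto simp: ternary_def)
    qed
  qed
qed

subsection \<open>Binary words\<close>

text \<open>This is \<open>B_word\<close> for an arbitrary list of multiplicities; trailing zero
  multiplicities are allowed because they occur along the orbits.\<close>

definition blocks :: "nat list \<Rightarrow> int list" where
  "blocks ms = concat (map (\<lambda>m. 0 # replicate m 1) ms)"

lemma blocks_simps [simp]:
  "blocks [] = []"
  "blocks (m # ms) = 0 # replicate m 1 @ blocks ms"
  "blocks (ms @ ms') = blocks ms @ blocks ms'"
  by (simp_all add: blocks_def)

lemma set_blocks: "set (blocks ms) \<subseteq> {0, 1}"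
  by (induction ms) auto

lemma hd_blocks: "blocks ms = [] \<or> hd (blocks ms) = 0"
  by (cases ms) auto

lemma ternary_binary_append:
  assumes "set X \<subseteq> {0, 1}" "set Y \<subseteq> {-1, 0}" "X \<noteq> []" "hd X = 0"
  shows "ternary (X @ Y)"
proof -
  have "slow_growth X" using assms(1) slow_growth_two_letters[of X 0] by simp
  moreover have "slow_growth Y" using assms(2) slow_growth_two_letters[of Y "-1"] by simp
  moreover have "last X \<in> {0, 1}" using assms(1,3) last_in_set by blast
  moreover have "Y = [] \<or> hd Y \<in> {-1, 0}" using assms(2) hd_in_set by blast
  ultimately have "qdv (X @ Y)" using assms by (auto simp: qdv_iff slow_growth_append)
  moreover have l: "set (X @ Y) \<subseteq> {-1, 0, 1}" using assms by auto
  moreover have "sorted_wrt (\<lambda>x y. x = -1 \<longrightarrow> y \<noteq> 2) w" if "set w \<subseteq> {-1, 0, 1}" for w :: "int list"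
    using that by (induction w) auto
  from this[OF l] have "sorted_wrt (\<lambda>x y. x = -1 \<longrightarrow> y \<noteq> 2) (X @ Y)" .
  ultimately show ?thesis by (auto simp: ternary_def)
qed

text \<open>Each use of \<open>ternary_B\<close> takes the 1 behind the leading 0 and appends it as
  a 0.\<close>

lemma NU_rotate_ones:
  assumes "set X \<subseteq> {0, 1}" "X = [] \<or> hd X = 0" "set Y \<subseteq> {-1, 0}"
  shows "NU\<^sup>*\<^sup>* (dyck_class (0 # replicate m 1 @ X @ Y)) (dyck_class (0 # X @ Y @ replicate m 0)) \<and>
    dfc (0 # X @ Y @ replicate m 0) = dfc (0 # replicate m 1 @ X @ Y)"
  using assms
proof (induction m arbitrary: Y)
  case (Suc m)
  have t: "ternary (0 # 1 # replicate m 1 @ X @ Y)"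
    using ternary_binary_append[of "0 # replicate (Suc m) 1 @ X" Y] Suc.prems by auto
  have "Y = [] \<or> hd Y \<in> {-1, 0}" using Suc.prems(3) hd_in_set by blast
  then have h: "replicate m 1 @ X @ Y = [] \<or> hd (replicate m 1 @ X @ Y) \<le> 1"
    using Suc.prems(2) by (cases m) (auto simp: hd_append)
  have *: "NU\<^sup>*\<^sup>* (dyck_class (0 # replicate m 1 @ X @ (Y @ [0]))) (dyck_class (0 # X @ (Y @ [0]) @ replicate m 0)) \<and>
    dfc (0 # X @ (Y @ [0]) @ replicate m 0) = dfc (0 # replicate m 1 @ X @ (Y @ [0]))"
    using Suc.prems by (intro Suc.IH) auto
  show ?case
    using ternary_B[OF t h] * by (auto intro: converse_rtranclp_into_rtranclp)
qed simp

text \<open>Block by block, the ones move to the end as zeros and then the 0 moves there as -1. At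
  the last block the word has become 0 followed by -1, and \<open>ternary_A1\<close> raises
  everything back, creating one new zero.\<close>

lemma NU_rotate_blocks:
  assumes "set Y \<subseteq> {-1, 0}" "Y \<noteq> []" "hd Y = -1"
  shows "NU\<^sup>*\<^sup>* (dyck_class (blocks (m # ms) @ Y))
    (dyck_class (0 # incr Y @ replicate m 1 @ blocks ms @ [0]))"
  using assms
proof (induction ms arbitrary: m Y)
  case Nil
  have "NU\<^sup>*\<^sup>* (dyck_class (0 # replicate m 1 @ [] @ Y)) (dyck_class (0 # [] @ Y @ replicate m 0))"
    using NU_rotate_ones[of "[]" Y m] Nil by simp
  moreover have "ternary (0 # Y @ replicate m 0)"
    using ternary_binary_append[of "[0]" "Y @ replicate m 0"] Nil by auto
  then have "NU (dyck_class (0 # Y @ replicate m 0)) (dyck_class (0 # incr (Y @ replicate m 0) @ [0]))"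
    using ternary_A1[of "Y @ replicate m 0"] Nil by auto
  ultimately show ?case by (auto intro: rtranclp.rtrancl_into_rtrancl simp: map_replicate)
next
  case (Cons m' ms)
  let ?X = "blocks (m' # ms)"
  have "NU\<^sup>*\<^sup>* (dyck_class (0 # replicate m 1 @ ?X @ Y)) (dyck_class (0 # ?X @ Y @ replicate m 0))"
    using NU_rotate_ones[of ?X Y m] Cons.prems set_blocks[of "m' # ms"] hd_blocks[of "m' # ms"] by blast
  moreover have "ternary (0 # ?X @ Y @ replicate m 0)"
    using ternary_binary_append[of "0 # ?X" "Y @ replicate m 0"] Cons.prems set_blocks[of "m' # ms"] by auto
  then have "NU (dyck_class (0 # ?X @ Y @ replicate m 0)) (dyck_class (?X @ (Y @ replicate m 0 @ [-1])))"
    using ternary_A0[of "?X @ Y @ replicate m 0"] by simp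
  moreover have "NU\<^sup>*\<^sup>* (dyck_class (?X @ (Y @ replicate m 0 @ [-1])))
     (dyck_class (0 # incr (Y @ replicate m 0 @ [-1]) @ replicate m' 1 @ blocks ms @ [0]))"
    using Cons.prems by (intro Cons.IH) auto
  ultimately have "NU\<^sup>*\<^sup>* (dyck_class (0 # replicate m 1 @ ?X @ Y))
     (dyck_class (0 # incr (Y @ replicate m 0 @ [-1]) @ replicate m' 1 @ blocks ms @ [0]))"
    by (meson rtranclp.rtrancl_into_rtrancl rtranclp_trans)
  then show ?case by (simp add: map_replicate)
qed

text \<open>One full rotation reproduces a binary word with an extra final 0, so words differing
  only in trailing zeros share an orbit.\<close>

lemma NU_append_zero: "NU\<^sup>*\<^sup>* (dyck_class (0 # blocks ms)) (dyck_class (0 # blocks ms @ [0]))"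
proof (cases ms)
  case Nil
  have "ternary [0]" using ternary_binary_append[of "[0]" "[]"] by simp
  then show ?thesis using ternary_A1[of "[]"] Nil by auto
next
  case (Cons m ms')
  have "ternary (0 # blocks ms)"
    using ternary_binary_append[of "0 # blocks ms" "[]"] set_blocks[of ms] by auto
  then have "NU (dyck_class (0 # blocks ms)) (dyck_class (blocks ms @ [-1]))"
    using ternary_A0[of "blocks ms"] Cons by simp
  moreover have "NU\<^sup>*\<^sup>* (dyck_class (blocks ms @ [-1])) (dyck_class (0 # blocks ms @ [0]))"
    using NU_rotate_blocks[of "[-1]" m ms'] Cons by simp
  ultimately show ?thesis by (rule converse_rtranclp_into_rtranclp)
qed

lemma NU_append_zeros:
  "NU\<^sup>*\<^sup>* (dyck_class (0 # blocks ms)) (dyck_class (0 # blocks (ms @ replicate e 0)))"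
proof (induction e)
  case (Suc e)
  have "ms @ replicate (Suc e) 0 = (ms @ replicate e 0) @ [0]"
    by (simp add: replicate_append_same)
  then have "blocks (ms @ replicate (Suc e) 0) = blocks (ms @ replicate e 0) @ [0]"
    by (simp only: blocks_simps) simp
  then show ?case
    using rtranclp_trans[OF Suc NU_append_zero[of "ms @ replicate e 0"]] by (simp only:)
qed simp

lemma binary_eq_blocks:
  "set t \<subseteq> {0, 1} \<Longrightarrow> t = [] \<or> hd t = 0 \<Longrightarrow> \<exists>ms. t = blocks ms"
proof (induction t rule: rev_induct)
  case Nil
  show ?case by (intro exI[of _ "[]"]) simp
next
  case (snoc x t)
  have "t = [] \<or> hd t = 0" using snoc.prems(2) by (cases t) auto
  then obtain ms where ms: "t = blocks ms" using snoc by auto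
  consider "x = 0" | "x = 1" using snoc.prems by auto
  then show ?case
  proof cases
    case 1
    then have "t @ [x] = blocks (ms @ [0])" using ms by simp
    then show ?thesis by blast
  next
    case 2
    then have "ms \<noteq> []" using snoc.prems(2) ms by auto
    then obtain ms' m where "ms = ms' @ [m]" by (metis rev_exhaust)
    then have "t @ [x] = blocks (ms' @ [Suc m])"
      using 2 ms by (simp add: replicate_append_same)
    then show ?thesis by blast
  qed
qed

lemma num_blocks: "num 0 (blocks ms) = int (length ms)" "num 1 (blocks ms) = int (sum_list ms)"
  by (induction ms) auto

lemma blocks_letters: "set (blocks ms) \<subseteq> {-1, 0, 1, 2}" "num (-1) (blocks ms) = 0" "num 2 (blocks ms) = 0"
  using set_blocks[of ms] by (auto simp: num_def count_list_0_iff)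

text \<open>A 1 in block \<open>i\<close> has \<open>i + 2\<close> zeros before it, each a pair not
  counted by dinv, and its own value 1 is subtracted. A 1 before a 0 is counted by dinv and adds
  nothing.\<close>

lemma dfc_blocks: "dfc (0 # blocks ms) = int (\<Sum>i<length ms. Suc i * ms ! i)"
proof (induction ms rule: rev_induct)
  case (snoc m ms)
  have "dfc (0 # blocks (ms @ [m])) = dfc (0 # blocks ms) + int (m * Suc (length ms))"
    using blocks_letters[of ms] num_blocks[of ms]
    by (simp add: dfc_simps algebra_simps)
  then show ?case using snoc by (simp add: nth_append)
qed (simp add: dfc_def)

subsection \<open>Tail initiators\<close>

lemma B_word_eq_blocks: "B_word \<mu> = blocks (map (count_list \<mu>) [1..<part \<mu> 1 + 1])"
  by (simp add: B_word_def blocks_def o_def)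

lemma partition_parts_le: "is_partition \<mu> \<Longrightarrow> x \<in> set \<mu> \<Longrightarrow> 1 \<le> x \<and> x \<le> part \<mu> 1"
  by (cases \<mu>) (auto simp: is_partition_def part_def Suc_le_eq)

lemma sum_length_part_counts:
  assumes "is_partition \<mu>"
  shows "(\<Sum>i<part \<mu> 1. Suc i * count_list \<mu> (Suc i)) = sum_list \<mu>"
    and "(\<Sum>i<part \<mu> 1. count_list \<mu> (Suc i)) = length \<mu>"
proof -
  have sub: "set \<mu> \<subseteq> {1..part \<mu> 1}" using partition_parts_le[OF assms] by auto
  have im: "{1..part \<mu> 1} = Suc ` {..<part \<mu> 1}"
    by (simp add: image_Suc_lessThan)
  have "sum_list \<mu> = (\<Sum>x\<in>set \<mu>. count_list \<mu> x * x)"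
    using sum_list_map_eq_sum_count[of id \<mu>] by simp
  also have "\<dots> = (\<Sum>x\<in>{1..part \<mu> 1}. count_list \<mu> x * x)"
    by (intro sum.mono_neutral_left) (use sub in \<open>auto simp: count_list_0_iff\<close>)
  also have "\<dots> = (\<Sum>i<part \<mu> 1. Suc i * count_list \<mu> (Suc i))"
    unfolding im by (subst sum.reindex) (auto simp: mult.commute)
  finally show "(\<Sum>i<part \<mu> 1. Suc i * count_list \<mu> (Suc i)) = sum_list \<mu>" ..
  have "length \<mu> = (\<Sum>x\<in>{1..part \<mu> 1}. count_list \<mu> x)"
    using sum_count_set[OF sub] by simp
  also have "\<dots> = (\<Sum>i<part \<mu> 1. count_list \<mu> (Suc i))"
    unfolding im by (subst sum.reindex) auto
  finally show "(\<Sum>i<part \<mu> 1. count_list \<mu> (Suc i)) = length \<mu>" ..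
qed

lemma B_word_facts:
  assumes "is_partition \<mu>"
  shows "set (B_word \<mu>) \<subseteq> {0, 1}" "B_word \<mu> = [] \<or> hd (B_word \<mu>) = 0"
    "num 0 (B_word \<mu>) = int (part \<mu> 1)" "num 1 (B_word \<mu>) = int (length \<mu>)"
    "dfc (0 # B_word \<mu>) = int (sum_list \<mu>)" "length (B_word \<mu>) = part \<mu> 1 + length \<mu>"
proof -
  let ?ms = "map (count_list \<mu>) [1..<part \<mu> 1 + 1]"
  show "set (B_word \<mu>) \<subseteq> {0, 1}" unfolding B_word_eq_blocks by (rule set_blocks)
  show "B_word \<mu> = [] \<or> hd (B_word \<mu>) = 0" unfolding B_word_eq_blocks by (rule hd_blocks)
  have s: "sum_list ?ms = length \<mu>"
  proof -
    have "sum_list ?ms = (\<Sum>i<part \<mu> 1. count_list \<mu> (Suc i))"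
      by (subst sum_list_sum_nth) (simp add: atLeast0LessThan del: upt_Suc)
    then show ?thesis using sum_length_part_counts(2)[OF assms] by simp
  qed
  show n0: "num 0 (B_word \<mu>) = int (part \<mu> 1)" and n1: "num 1 (B_word \<mu>) = int (length \<mu>)"
    unfolding B_word_eq_blocks num_blocks s by (simp_all del: upt_Suc)
  show "dfc (0 # B_word \<mu>) = int (sum_list \<mu>)"
    unfolding B_word_eq_blocks dfc_blocks
    using sum_length_part_counts(1)[OF assms] by (simp del: upt_Suc)
  have "int (length (B_word \<mu>)) = int (part \<mu> 1 + length \<mu>)"
    using nondinv_letters(5)[of "B_word \<mu>"] n0 n1 blocks_letters[of ?ms]
    unfolding B_word_eq_blocks by simp
  then show "length (B_word \<mu>) = part \<mu> 1 + length \<mu>" by simp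
qed

lemma partition_of_multiplicities:
  "\<exists>\<mu>. is_partition \<mu> \<and> (\<forall>i<length ms. count_list \<mu> (Suc i) = ms ! i) \<and> (\<forall>x\<in>set \<mu>. x \<le> length ms) \<and>
     sum_list \<mu> = (\<Sum>i<length ms. Suc i * ms ! i)"
proof (induction ms rule: rev_induct)
  case Nil
  show ?case by (intro exI[of _ "[]"]) (simp add: is_partition_def)
next
  case (snoc m ms)
  then obtain \<mu> where m: "is_partition \<mu>" "\<forall>i<length ms. count_list \<mu> (Suc i) = ms ! i"
     "\<forall>x\<in>set \<mu>. x \<le> length ms" "sum_list \<mu> = (\<Sum>i<length ms. Suc i * ms ! i)" by blast
  let ?\<mu> = "replicate m (Suc (length ms)) @ \<mu>"
  have c: "count_list (replicate n x) y = (if x = y then n else 0)" for n and x y :: nat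
    by (induction n) auto
  have "count_list \<mu> (Suc (length ms)) = 0" using m(3) by (auto simp: count_list_0_iff)
  then have "\<forall>i<length (ms @ [m]). count_list ?\<mu> (Suc i) = (ms @ [m]) ! i"
    using m(2) by (auto simp: c nth_append less_Suc_eq count_list_append)
  moreover have "is_partition ?\<mu>"
    using m(1,3) by (auto simp: is_partition_def sorted_wrt_append sorted_wrt_replicate intro: le_SucI)
  moreover have "sum_list ?\<mu> = (\<Sum>i<length (ms @ [m]). Suc i * (ms @ [m]) ! i)"
    using m(4) by (simp add: nth_append sum_list_replicate)
  ultimately show ?case using m(3) by (intro exI[of _ ?\<mu>]) (auto intro: le_SucI)
qed

text \<open>The nonzero last multiplicity makes the number of blocks equal to the largest part,
  where \<open>B_word\<close> stops.\<close>

lemma blocks_eq_B_word: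
  assumes "ms = [] \<or> last ms \<noteq> 0"
  shows "\<exists>\<mu>. is_partition \<mu> \<and> B_word \<mu> = blocks ms"
proof -
  obtain \<mu> where m: "is_partition \<mu>" "\<forall>i<length ms. count_list \<mu> (Suc i) = ms ! i"
     "\<forall>x\<in>set \<mu>. x \<le> length ms" using partition_of_multiplicities by blast
  have "part \<mu> 1 = length ms"
  proof (cases "ms = []")
    case True
    then show ?thesis using m(1,3) by (cases \<mu>) (auto simp: is_partition_def part_def)
  next
    case False
    then have "count_list \<mu> (Suc (length ms - 1)) \<noteq> 0"
      using assms m(2)[rule_format, of "length ms - 1"] by (simp add: last_conv_nth)
    then have "length ms \<in> set \<mu>" using False by (simp add: count_list_0_iff)
    then have "length ms \<le> part \<mu> 1" and "\<mu> \<noteq> []" using partition_parts_le[OF m(1)] by auto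
    moreover from this(2) have "part \<mu> 1 \<in> set \<mu>" by (cases \<mu>) (auto simp: part_def)
    ultimately show ?thesis using m(3) by force
  qed
  then have "map (count_list \<mu>) [1..<part \<mu> 1 + 1] = ms"
    using m(2) by (intro nth_equalityI) (auto simp del: upt_Suc)
  then show ?thesis using m(1) B_word_eq_blocks by metis
qed

text \<open>Rotating the ones after the leading 0 to the end gives \<open>0 # blocks ms\<close>.
  Deleting its trailing empty blocks gives a word of the form \<open>TI \<mu>\<close>, and the orbit
  of that class restores them.\<close>

lemma binary_joins_TI:
  assumes "qdv b" "set b \<subseteq> {0, 1}"
  shows "\<exists>\<mu> E. is_partition \<mu> \<and> int (sum_list \<mu>) = dfc b \<and> NU\<^sup>*\<^sup>* (dyck_class b) E \<and> NU\<^sup>*\<^sup>* (TI \<mu>) E"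
proof -
  obtain u where u: "b = 0 # u" using assms(1) by (cases b) (auto simp: qdv_iff)
  obtain m t where t: "u = replicate m 1 @ t" "t = [] \<or> hd t \<noteq> 1"
    using replicate_prefix[of u 1] by blast
  have st: "set t \<subseteq> {0, 1}" using assms(2) u t by auto
  then have ht: "t = [] \<or> hd t = 0" using t(2) hd_in_set by blast
  have st': "set (t @ replicate m 0) \<subseteq> {0, 1}" using st by auto
  have "t @ replicate m 0 = [] \<or> hd (t @ replicate m 0) = 0" using ht by (cases m) (auto simp: hd_append)
  from binary_eq_blocks[OF st' this] obtain ms where ms: "t @ replicate m 0 = blocks ms" by blast
  obtain ms1 e where e: "ms = ms1 @ replicate e 0" "ms1 = [] \<or> last ms1 \<noteq> 0"
    using replicate_suffix[of ms 0] by blast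
  obtain \<mu> where \<mu>: "is_partition \<mu>" "B_word \<mu> = blocks ms1" using blocks_eq_B_word[OF e(2)] by blast
  have r: "NU\<^sup>*\<^sup>* (dyck_class b) (dyck_class (0 # blocks ms)) \<and> dfc (0 # blocks ms) = dfc b"
    using NU_rotate_ones[OF st ht, of "[]" m] u t ms by simp
  \<comment> \<open>Empty blocks have weight 0 in the sum of \<open>dfc_blocks\<close>.\<close>
  have "dfc (0 # blocks ms) = dfc (0 # blocks ms1)"
    unfolding dfc_blocks e(1) length_append
    by (subst sum.mono_neutral_right[of "{..<length ms1 + length (replicate e 0)}" "{..<length ms1}"])
       (auto simp: nth_append)
  then have "int (sum_list \<mu>) = dfc b" using B_word_facts(5)[OF \<mu>(1)] \<mu>(2) r by simp
  moreover have "NU\<^sup>*\<^sup>* (TI \<mu>) (dyck_class (0 # blocks ms))"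
    unfolding TI_def \<mu>(2) e(1) by (rule NU_append_zeros)
  ultimately show ?thesis using \<mu>(1) r by blast
qed

text \<open>With unique predecessors the two walks back from \<open>z\<close> agree step by step,
  and the one that ends at \<open>x\<close> cannot be the shorter one because \<open>x\<close> has
  no predecessor.\<close>

lemma rtranclp_backward_deterministic:
  assumes "\<And>x y z. r x z \<Longrightarrow> r y z \<Longrightarrow> x = y" and "r\<^sup>*\<^sup>* y z" "r\<^sup>*\<^sup>* x z" "\<nexists>c. r c x"
  shows "r\<^sup>*\<^sup>* x y"
  using assms(2,3)
proof (induction rule: rtranclp_induct)
  case (step z' z)
  from step.prems show ?case
  proof (cases rule: rtranclp.cases)
    case rtrancl_refl
    then show ?thesis using step.hyps assms(4) by blast
  next
    case (rtrancl_into_rtrancl b)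
    then have "b = z'" using step.hyps assms(1) by blast
    then show ?thesis using rtrancl_into_rtrancl step.IH by blast
  qed
qed

text \<open>The orbits of \<open>D\<close> and of \<open>TI \<mu>\<close> meet in \<open>E\<close>.
  Walking back from \<open>E\<close>, the path passes \<open>TI \<mu>\<close> and stops at
  \<open>D\<close>, so iterating \<open>ND\<close> from \<open>TI \<mu>\<close> ends there.\<close>

lemma TI2_surj:
  assumes "ternary D" "\<nexists>C. NU C (dyck_class D)"
  shows "\<exists>\<mu>. is_partition \<mu> \<and> int (sum_list \<mu>) = dfc D \<and> TI2 \<mu> = dyck_class D"
proof -
  obtain b where b: "NU\<^sup>*\<^sup>* (dyck_class D) (dyck_class b)" "dfc b = dfc D" "qdv b" "set b \<subseteq> {0, 1}"
    using reaches_binary[OF assms(1)] by blast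
  obtain \<mu> E where m: "is_partition \<mu>" "int (sum_list \<mu>) = dfc b" "NU\<^sup>*\<^sup>* (dyck_class b) E" "NU\<^sup>*\<^sup>* (TI \<mu>) E"
    using binary_joins_TI[OF b(3,4)] by blast
  have "NU\<^sup>*\<^sup>* (dyck_class D) (TI \<mu>)"
    by (rule rtranclp_backward_deterministic[of NU, OF NU_inj m(4) rtranclp_trans[OF b(1) m(3)] assms(2)])
  then have D: "ND\<^sup>*\<^sup>* (TI \<mu>) (dyck_class D)"
    unfolding ND_def by (simp add: rtranclp_conversep)
  have "TI2 \<mu> = dyck_class D"
    unfolding TI2_def
  proof (rule the_equality)
    show "ND\<^sup>*\<^sup>* (TI \<mu>) (dyck_class D) \<and> \<not> (\<exists>E. ND (dyck_class D) E)"
      using D assms(2) by (simp add: ND_def)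
  next
    \<comment> \<open>Any other endpoint \<open>E\<close> also reaches \<open>TI \<mu>\<close>,
      hence reaches \<open>D\<close> by the same argument; as \<open>D\<close> has no predecessor,
      the path has length 0.\<close>
    fix E assume E: "ND\<^sup>*\<^sup>* (TI \<mu>) E \<and> \<not> (\<exists>F. ND E F)"
    then have "NU\<^sup>*\<^sup>* E (TI \<mu>)" "\<nexists>C. NU C E" by (auto simp: ND_def rtranclp_conversep)
    then have "NU\<^sup>*\<^sup>* E (dyck_class D)"
      using rtranclp_backward_deterministic[of NU "dyck_class D" "TI \<mu>" E] NU_inj
        \<open>NU\<^sup>*\<^sup>* (dyck_class D) (TI \<mu>)\<close> by blast
    then show "E = dyck_class D"
      by (cases rule: rtranclp.cases) (use assms(2) in auto)
  qed
  then show ?thesis using m b by auto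
qed

section \<open>Flagpole vectors\<close>

lemma last_B_word: "is_partition lam \<Longrightarrow> lam \<noteq> [] \<Longrightarrow> B_word lam \<noteq> [] \<and> last (B_word lam) = 1"
proof -
  assume a: "is_partition lam" "lam \<noteq> []"
  then have p: "part lam 1 \<in> set lam" by (cases lam) (auto simp: part_def)
  then have "1 \<le> part lam 1" using partition_parts_le[OF a(1)] by auto
  then obtain r where r: "part lam 1 = Suc r" by (cases "part lam 1") auto
  obtain c where c: "count_list lam (part lam 1) = Suc c"
    using p count_list_0_iff[of lam "part lam 1"] by (cases "count_list lam (part lam 1)") auto
  have "[1..<part lam 1 + 1] = [1..<part lam 1] @ [part lam 1]"
    using r by simp
  then have "B_word lam = blocks (map (count_list lam) [1..<part lam 1]) @ 0 # replicate (Suc c) 1"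
    unfolding B_word_eq_blocks by (simp only: map_append list.map blocks_simps c) simp
  then show ?thesis by simp
qed

lemma B_word_Nil [simp]: "B_word [] = []"
  by (simp add: B_word_def part_def)

text \<open>For nonempty \<open>lam\<close> the 2 is the raised final 1 of
  \<open>B_word lam\<close>; for empty \<open>lam\<close> it comes from the run of 2s, which is
  nonempty since \<open>2 \<le> a\<close>.\<close>

lemma flagpole_vec_last:
  assumes "is_partition lam" "2 \<le> a"
  shows "last (flagpole_vec lam a 0) = 2" "\<exists>Y. flagpole_vec lam a 1 = Y @ [2, 1]"
proof -
  obtain m where m: "a = Suc (Suc m)" using le_Suc_ex[OF assms(2)] by auto
  show "last (flagpole_vec lam a 0) = 2"
    using last_B_word[OF assms(1)] m by (cases "lam = []") (auto simp: flagpole_vec_def last_map)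
  show "\<exists>Y. flagpole_vec lam a 1 = Y @ [2, 1]"
  proof (cases "lam = []")
    case True
    have "flagpole_vec lam a 1 = ([0, 0, 1] @ replicate m 2) @ [2, 1]"
      using True m by (simp add: flagpole_vec_def replicate_append_same)
    then show ?thesis by blast
  next
    case False
    then obtain B where "B_word lam = B @ [1]"
      using last_B_word[OF assms(1)] by (metis append_butlast_last_id)
    then have "flagpole_vec lam a 1 = ([0, 0, 1] @ replicate (a - 1) 2 @ incr B) @ [2, 1]"
      by (simp add: flagpole_vec_def)
    then show ?thesis by blast
  qed
qed

text \<open>The deficit is the length minus 2 plus \<open>sum_list lam\<close>; once the deficit and
  \<open>lam\<close> are prescribed, this determines \<open>a\<close>.\<close>

lemma flagpole_vec_facts:
  assumes "is_partition lam" "2 \<le> a" "\<epsilon> \<in> {0, 1}"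
  shows "ternary (flagpole_vec lam a \<epsilon>)"
    "length (flagpole_vec lam a \<epsilon>) = a + 3 + part lam 1 + length lam"
    "dfc (flagpole_vec lam a \<epsilon>) = int (a + 1 + part lam 1 + length lam + sum_list lam)"
    "hd (tl (flagpole_vec lam a \<epsilon>)) = 0"
proof -
  let ?B = "B_word lam"
  obtain m where m: "a = Suc (Suc m)" using le_Suc_ex[OF assms(2)] by auto
  note B = B_word_facts[OF assms(1)]
  have iB: "set (incr ?B) \<subseteq> {1, 2}" using B(1) by auto
  then have iB': "set (incr ?B) \<subseteq> {-1, 0, 1, 2}" by auto
  have B': "set ?B \<subseteq> {-1, 0, 1, 2}" using B(1) by auto
  have s: "slow_growth (incr ?B)" using slow_growth_two_letters[of "incr ?B" 1] iB by simp
  have n: "num (-1) ?B = 0" "num (-2) ?B = 0" "num 2 ?B = 0"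
    using B(1) by (auto simp: num_def count_list_0_iff)
  \<comment> \<open>In \<open>0 # ?B\<close> the pairs with the leading 0 cancel against the letter
    sum, so the pairs inside \<open>?B\<close> alone give the size. This number survives raising the
    letters.\<close>
  have np: "nondinv_pairs ?B = int (sum_list lam)"
    using B(5) n by (simp add: dfc_def nondinv_letters[OF B'])
  have h: "incr ?B = [] \<or> hd (incr ?B) = 1" using B(2) by (cases ?B) auto
  have l: "incr ?B = [] \<or> last (incr ?B) \<in> {1, 2}" using iB last_in_set by blast
  have e: "\<epsilon> = 0 \<or> \<epsilon> = 1" using assms(3) by auto
  have w: "sorted_wrt (\<lambda>x y. x = -1 \<longrightarrow> y \<noteq> 2) w" if "set w \<subseteq> {0, 1, 2}" for w :: "int list"
    using that by (induction w) auto
  have set3: "set (flagpole_vec lam a \<epsilon>) \<subseteq> {0, 1, 2}"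
    using iB e m by (auto simp: flagpole_vec_def)
  have "qdv (flagpole_vec lam a \<epsilon>)"
    using s h l e m
    by (cases "incr ?B = []"; cases m)
      (auto simp: flagpole_vec_def qdv_Cons slow_growth_Cons slow_growth_append hd_append last_replicate)
  then show "ternary (flagpole_vec lam a \<epsilon>)"
    using set3 w[OF set3] by (auto simp: ternary_def)
  show "length (flagpole_vec lam a \<epsilon>) = a + 3 + part lam 1 + length lam"
    using B(6) e m by (auto simp: flagpole_vec_def)
  show "hd (tl (flagpole_vec lam a \<epsilon>)) = 0" by (simp add: flagpole_vec_def)
  show "dfc (flagpole_vec lam a \<epsilon>) = int (a + 1 + part lam 1 + length lam + sum_list lam)"
    using e
  proof
    assume "\<epsilon> = 0"
    then show ?thesis
      using m np n B(3,4,6) iB'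
      by (simp add: flagpole_vec_def dfc_simps nondinv_letters(6)[OF B'] algebra_simps)
  next
    assume "\<epsilon> = 1"
    then show ?thesis
      using m np n B(3,4,6) iB'
      by (simp add: flagpole_vec_def dfc_simps nondinv_letters(6)[OF B'] algebra_simps)
  qed
qed

text \<open>The vector starts with 00, so it is reduced. An image under \<open>NU1\<close> would
  have last letter at most 0, an image under \<open>NU2\<close> would end in 01 or 11; this one ends
  in 2 or in 21.\<close>

lemma flagpole_vec_initial:
  assumes "is_partition lam" "2 \<le> a" "\<epsilon> \<in> {0, 1}"
  shows "\<nexists>C. NU C (dyck_class (flagpole_vec lam a \<epsilon>))"
proof
  assume "\<exists>C. NU C (dyck_class (flagpole_vec lam a \<epsilon>))"
  then obtain C where C: "NU C (dyck_class (flagpole_vec lam a \<epsilon>))" ..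
  let ?v = "flagpole_vec lam a \<epsilon>"
  note f = flagpole_vec_facts[OF assms]
  have q: "qdv ?v" using f(1) by (simp add: ternary_def)
  obtain Y where Y: "\<epsilon> = 0 \<and> last ?v = 2 \<or> \<epsilon> = 1 \<and> ?v = Y @ [2, 1]"
    using flagpole_vec_last[OF assms(1,2)] assms(3) by auto
  then have "0 < last ?v" by auto
  then have "\<not> NU1 C (dyck_class ?v)"
    using NU1_reduced_last[OF _ q _ refl] f(4) by fastforce
  then have "NU2 C (dyck_class ?v)" using C by (simp add: NU_def)
  then obtain w Z c where w: "qdv w" "hd (tl w) = 0" "w = Z @ [c, 1]" "c \<in> {0, 1}" "dyck_class ?v = dyck_class w"
    using NU2_reduced by blast
  have "?v = w" using dyck_class_reduced_eq[OF w(5) q w(1)] f(4) w(2) by simp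
  then show False using Y w(3,4) by auto
qed

section \<open>Injectivity of the flagpole parametrization\<close>

lemma blocks_inj: "blocks ms = blocks ms' \<Longrightarrow> ms = ms'"
proof (induction ms arbitrary: ms')
  case Nil
  then show ?case by (cases ms') auto
next
  case (Cons m ms)
  then obtain m' ms'' where ms': "ms' = m' # ms''" by (cases ms') auto
  have "replicate m 1 @ (blocks ms @ [0]) = replicate m' 1 @ (blocks ms'' @ [0])"
    using Cons.prems ms' by simp
  then have "m = m' \<and> blocks ms @ [0] = blocks ms'' @ [0]"
    by (rule replicate_append_eqD) (use hd_blocks[of ms] hd_blocks[of ms''] in \<open>auto simp: hd_append\<close>)
  then show ?case using Cons.IH ms' by simp
qed

lemma decreasing_list_eqI:
  fixes xs :: "nat list"
  assumes "sorted_wrt (\<ge>) xs" "sorted_wrt (\<ge>) ys" "\<And>x. count_list xs x = count_list ys x"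
  shows "xs = ys"
  using assms
proof (induction xs arbitrary: ys)
  case Nil
  then have "set ys = {}" using count_list_0_iff by (metis count_list.simps(1) equals0I)
  then show ?case by simp
next
  case (Cons x xs)
  have s: "set (x # xs) = set ys"
    using Cons.prems(3) count_list_0_iff by (metis (no_types, lifting) subsetI subset_antisym)
  then obtain y ys' where y: "ys = y # ys'" by (cases ys) auto
  have "y \<in> set (x # xs)" "x \<in> set (y # ys')" using s y by auto
  then have xy: "x = y" using Cons.prems(1,2) y by fastforce
  have "count_list xs z = count_list ys' z" for z
    using Cons.prems(3)[of z] y xy by (simp split: if_splits)
  then show ?case using Cons.IH[of ys'] Cons.prems(1,2) y xy by simp
qed

lemma B_word_inj:
  assumes "is_partition lam" "is_partition lam'" "B_word lam = B_word lam'"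
  shows "lam = lam'"
proof -
  have p: "part lam 1 = part lam' 1" using B_word_facts(3)[OF assms(1)] B_word_facts(3)[OF assms(2)] assms(3) by simp
  have "map (count_list lam) [1..<part lam 1 + 1] = map (count_list lam') [1..<part lam 1 + 1]"
    using assms(3) blocks_inj unfolding B_word_eq_blocks p by blast
  then have c: "count_list lam x = count_list lam' x" if "1 \<le> x" "x \<le> part lam 1" for x
    using that by (auto simp del: upt_Suc)
  have c0: "count_list l x = 0" if "\<not> (1 \<le> x \<and> x \<le> part lam 1)" "l = lam \<or> l = lam'" for x l
    using that partition_parts_le[OF assms(1), of x] partition_parts_le[OF assms(2), of x] p
    by (auto simp: count_list_0_iff)
  have "count_list lam x = count_list lam' x" for x
    by (cases "1 \<le> x \<and> x \<le> part lam 1") (simp_all only: c c0 simp_thms)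
  then show ?thesis
    using assms(1,2) by (intro decreasing_list_eqI) (auto simp: is_partition_def)
qed

text \<open>The last letter tells \<epsilon>, and the run of 2s after 001 is ended by the first 1,
  which isolates the raised \<open>B_word\<close>.\<close>

lemma flagpole_vec_inj:
  assumes "is_partition lam" "is_partition lam'" "2 \<le> a" "2 \<le> a'" "\<epsilon> \<in> {0, 1}" "\<epsilon>' \<in> {0, 1}"
    and "dyck_class (flagpole_vec lam a \<epsilon>) = dyck_class (flagpole_vec lam' a' \<epsilon>')"
  shows "lam = lam' \<and> \<epsilon> = \<epsilon>'"
proof -
  note f = flagpole_vec_facts[OF assms(1,3,5)] and f' = flagpole_vec_facts[OF assms(2,4,6)]
  have eq: "flagpole_vec lam a \<epsilon> = flagpole_vec lam' a' \<epsilon>'"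
    using dyck_class_reduced_eq[OF assms(7)] f(1,4) f'(1,4) by (simp add: ternary_def)
  have l: "last (flagpole_vec lam a 1) = 1" "last (flagpole_vec lam' a' 1) = 1"
    by (simp_all add: flagpole_vec_def)
  have e: "\<epsilon> = \<epsilon>'"
    using eq l flagpole_vec_last(1)[OF assms(1,3)] flagpole_vec_last(1)[OF assms(2,4)] assms(5,6) by auto

  have h: "hd (incr (B_word l) @ [1]) = 1" if "is_partition l" for l
    using B_word_facts(2)[OF that] by (auto simp: hd_append hd_map)
  \<comment> \<open>A final 1 is added also for \<epsilon> = 0, so that the run of 2s is followed by
    a 1 even when \<open>lam\<close> is empty.\<close>
  have "incr (B_word lam) @ [1] = incr (B_word lam') @ [1]"
  proof (cases "\<epsilon> = 0")
    case True
    then have "replicate a 2 @ incr (B_word lam) @ [1] = replicate a' 2 @ incr (B_word lam') @ [1]"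
      using eq e by (simp add: flagpole_vec_def)
    then have "a = a' \<and> incr (B_word lam) @ [1] = incr (B_word lam') @ [1]"
      by (rule replicate_append_eqD) (use h assms in auto)
    then show ?thesis ..
  next
    case False
    then have "replicate (a - 1) 2 @ incr (B_word lam) @ [1] = replicate (a' - 1) 2 @ incr (B_word lam') @ [1]"
      using eq e by (simp add: flagpole_vec_def)
    then have "a - 1 = a' - 1 \<and> incr (B_word lam) @ [1] = incr (B_word lam') @ [1]"
      by (rule replicate_append_eqD) (use h assms in auto)
    then show ?thesis ..
  qed
  then have "shift (B_word lam) = shift (B_word lam')" by simp
  then have "B_word lam = B_word lam'" by (rule inj_shift)
  then show ?thesis using B_word_inj assms e by blast
qed

section \<open>Counting flagpole partitions\<close>

definition partitions_of :: "nat \<Rightarrow> nat list set" where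
  "partitions_of j = {lam. is_partition lam \<and> sum_list lam = j}"

lemma length_le_sum_list: "is_partition lam \<Longrightarrow> length lam \<le> sum_list lam"
  by (induction lam) (auto simp: is_partition_def)

lemma finite_partitions_of: "finite (partitions_of j)"
proof (rule finite_subset)
  show "partitions_of j \<subseteq> {xs. set xs \<subseteq> {..j} \<and> length xs \<le> j}"
    using length_le_sum_list member_le_sum_list by (fastforce simp: partitions_of_def)
  show "finite {xs :: nat list. set xs \<subseteq> {..j} \<and> length xs \<le> j}"
    by (rule finite_lists_length_le) simp
qed

lemma num_partitions_eq: "num_partitions j = card (partitions_of j)"
  by (simp add: num_partitions_def partitions_of_def)

lemma part_length_le:
  "is_partition lam \<Longrightarrow> lam \<noteq> [] \<Longrightarrow> part lam 1 + length lam \<le> Suc (sum_list lam)"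
proof (cases lam)
  case (Cons x xs)
  assume "is_partition lam"
  then have "is_partition xs" using Cons by (simp add: is_partition_def)
  then show ?thesis using Cons length_le_sum_list[of xs] by (simp add: part_def)
qed simp

definition wide :: "nat \<Rightarrow> int \<Rightarrow> nat list set" where
  "wide j i = {lam \<in> partitions_of j. i \<le> int (part lam 1) + int (length lam) - 1}"

text \<open>For a nonempty partition of \<open>j\<close> the index lies between 1 and
  \<open>j\<close>. Hence the convention for nonpositive indices agrees with empty fibres, and the
  upper limit \<open>j\<close> loses nothing.\<close>

lemma sum_q_count:
  assumes "1 \<le> j"
  shows "(\<Sum>i = i0..int j. int (q_count i j)) = int (card (wide j i0))"
proof -
  let ?Q = "\<lambda>i. {lam \<in> partitions_of j. int (part lam 1) + int (length lam) - 1 = i}"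
  have ne: "lam \<noteq> []" if "lam \<in> partitions_of j" for lam
    using that assms by (auto simp: partitions_of_def)
  have pos: "1 \<le> int (part lam 1) + int (length lam) - 1 \<and> int (part lam 1) + int (length lam) - 1 \<le> int j"
    if "lam \<in> partitions_of j" for lam
  proof -
    have "lam \<noteq> []" "is_partition lam" "sum_list lam = j" using that ne by (auto simp: partitions_of_def)
    moreover from this have "0 < part lam 1" by (intro part_pos) (auto simp: Suc_le_eq)
    ultimately show ?thesis using part_length_le[of lam] by (cases lam) auto
  qed
  have q: "q_count i j = card (?Q i)" for i
  proof (cases "i \<le> 0")
    case True
    then have "?Q i = {}" using pos by force
    then show ?thesis using True by (simp only: q_count_def if_True card.empty)
  next
    case False
    have "?Q i = {lam. is_partition lam \<and> sum_list lam = j \<and> int (part lam 1) + int (length lam) - 1 = i}"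
      by (auto simp: partitions_of_def)
    then show ?thesis using False by (simp add: q_count_def)
  qed
  have "wide j i0 = (\<Union>i\<in>{i0..int j}. ?Q i)"
    using pos by (auto simp: wide_def)
  then have "card (wide j i0) = (\<Sum>i\<in>{i0..int j}. card (?Q i))"
    by (simp only:) (rule card_UN_disjoint, auto simp: finite_partitions_of)
  then show ?thesis by (simp add: q)
qed

text \<open>At deficit \<open>k\<close> a flagpole vector with \<open>sum_list lam = j\<close> has
  length \<open>k + 2 - j\<close>. Both length conditions then say that \<open>lam\<close> and
  \<open>star lam\<close> avoid \<open>wide j (k - 3 - j)\<close>; for \<open>lam\<close> this is
  also the condition \<open>2 \<le> a\<close>.\<close>

lemma num_flagpoles_ge:
  assumes star: "size_preserving_involution star"
  shows "int (num_flagpoles star k) \<ge>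
           (\<Sum>j = 1..k - 1. 2 * max 0 (int (num_partitions j)
              - 2 * (\<Sum>i = int k - 3 - int j..int j. int (q_count i j))))"
proof -
  define P where "P = (\<lambda>j. {lam \<in> partitions_of j. lam \<notin> wide j (int k - 3 - int j) \<and> star lam \<notin> wide j (int k - 3 - int j)})"
  have st: "star lam \<in> partitions_of j \<and> star (star lam) = lam" if "lam \<in> partitions_of j" for lam j
    using star that by (auto simp: size_preserving_involution_def partitions_of_def)
  have P_ge: "max 0 (int (num_partitions j) - 2 * (\<Sum>i = int k - 3 - int j..int j. int (q_count i j))) \<le> int (card (P j))"
    if "1 \<le> j" for j
  proof -
    let ?W = "wide j (int k - 3 - int j)"
    let ?S = "{lam \<in> partitions_of j. star lam \<in> ?W}"
    have W: "finite ?W" "?W \<subseteq> partitions_of j"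
      using finite_partitions_of[of j] by (auto simp: wide_def)
    \<comment> \<open>An involution is injective, so at most \<open>card ?W\<close> partitions have
      their image in \<open>?W\<close>; this explains the factor 2 before the inner sum.\<close>
    have "inj_on star ?S" by (rule inj_on_inverseI[of _ star]) (use st in blast)
    then have "card ?S \<le> card ?W" using W by (intro card_inj_on_le[of star]) auto
    moreover have "partitions_of j \<subseteq> P j \<union> (?W \<union> ?S)" by (auto simp: P_def)
    then have "card (partitions_of j) \<le> card (P j \<union> (?W \<union> ?S))"
      using finite_partitions_of[of j] W by (intro card_mono) (auto simp: P_def)
    then have "card (partitions_of j) \<le> card (P j) + (card ?W + card ?S)"
      using card_Un_le[of "P j" "?W \<union> ?S"] card_Un_le[of ?W ?S] by linarith
    ultimately show ?thesis
      unfolding sum_q_count[OF that] num_partitions_eq by linarith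
  qed
  define S where "S = (\<Union>j\<in>{1..k - 1}. P j) \<times> {0, 1::nat}"
  \<comment> \<open>This solves the deficit formula of \<open>flagpole_vec_facts\<close> for
    \<open>a\<close> at deficit \<open>k\<close>; on \<open>S\<close> the subtractions are
    exact.\<close>
  define a where "a = (\<lambda>lam. k - 1 - sum_list lam - part lam 1 - length lam)"
  define good where "good = (\<lambda>p \<mu>. is_partition \<mu> \<and> sum_list \<mu> = k \<and>
      TI2 \<mu> = dyck_class (flagpole_vec (fst p) (a (fst p)) (snd p)))"
  define f where "f = (\<lambda>p. SOME \<mu>. good p \<mu>)"
  have S: "is_partition lam \<and> sum_list lam + part lam 1 + length lam + 3 \<le> k \<and>
      sum_list lam + part (star lam) 1 + length (star lam) + 3 \<le> k \<and> 2 \<le> a lam \<and>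
      k = a lam + 1 + sum_list lam + part lam 1 + length lam \<and> \<epsilon> \<in> {0, 1}"
    if p: "(lam, \<epsilon>) \<in> S" for lam \<epsilon>
  proof -
    obtain j where j: "lam \<in> P j" "\<epsilon> \<in> {0, 1}" using p by (auto simp: S_def)
    then have "lam \<in> partitions_of j" by (simp add: P_def)
    moreover from this have "star lam \<in> partitions_of j" using st by blast
    ultimately have "is_partition lam" "sum_list lam = j"
      "int (part lam 1) + int (length lam) - 1 < int k - 3 - int j"
      "int (part (star lam) 1) + int (length (star lam)) - 1 < int k - 3 - int j"
      using j(1) by (auto simp: P_def wide_def partitions_of_def)
    then show ?thesis using j(2) by (auto simp: a_def)
  qed
  have good: "good p (f p)" if "p \<in> S" for p
  proof -
    obtain lam \<epsilon> where p: "p = (lam, \<epsilon>)" by (cases p)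
    note s = S[OF that[unfolded p]]
    have "\<exists>\<mu>. is_partition \<mu> \<and> int (sum_list \<mu>) = dfc (flagpole_vec lam (a lam) \<epsilon>) \<and>
        TI2 \<mu> = dyck_class (flagpole_vec lam (a lam) \<epsilon>)"
      using s flagpole_vec_facts(1) flagpole_vec_initial by (intro TI2_surj) auto
    then obtain \<mu> where "is_partition \<mu>" "int (sum_list \<mu>) = dfc (flagpole_vec lam (a lam) \<epsilon>)"
        "TI2 \<mu> = dyck_class (flagpole_vec lam (a lam) \<epsilon>)" by blast
    moreover from this(2) have "sum_list \<mu> = k"
      using s flagpole_vec_facts(3)[of lam "a lam" \<epsilon>] by simp
    ultimately have "good p \<mu>" by (simp add: good_def p)
    then show ?thesis unfolding f_def by (rule someI)
  qed
  \<comment> \<open>A partition determines its class \<open>TI2\<close>, and that class determines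
    the pair by \<open>flagpole_vec_inj\<close>.\<close>
  have "inj_on f S"
  proof (rule inj_onI)
    fix p p' assume p: "p \<in> S" "p' \<in> S" "f p = f p'"
    obtain lam \<epsilon> lam' \<epsilon>' where pp: "p = (lam, \<epsilon>)" "p' = (lam', \<epsilon>')" by (cases p, cases p')
    have "dyck_class (flagpole_vec lam (a lam) \<epsilon>) = dyck_class (flagpole_vec lam' (a lam') \<epsilon>')"
      using good[OF p(1)] good[OF p(2)] p(3) pp by (simp add: good_def)
    then show "p = p'"
      using flagpole_vec_inj[of lam lam' "a lam" "a lam'" \<epsilon> \<epsilon>'] S[OF p(1)[unfolded pp]] S[OF p(2)[unfolded pp]] pp
      by auto
  qed
  moreover have "f ` S \<subseteq> {\<mu>. generalized_flagpole star \<mu> \<and> sum_list \<mu> = k}"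
  proof
    fix \<mu> assume "\<mu> \<in> f ` S"
    then obtain lam \<epsilon> where p: "(lam, \<epsilon>) \<in> S" "\<mu> = f (lam, \<epsilon>)" by auto
    note s = S[OF p(1)]
    have g: "is_partition \<mu>" "sum_list \<mu> = k" "TI2 \<mu> = dyck_class (flagpole_vec lam (a lam) \<epsilon>)"
      using good[OF p(1)] p(2) by (auto simp: good_def)
    have "length (flagpole_vec lam (a lam) \<epsilon>) = a lam + 3 + part lam 1 + length lam"
      using flagpole_vec_facts(2)[of lam "a lam" \<epsilon>] s by blast
    then have "5 + part lam 1 + length lam \<le> length (flagpole_vec lam (a lam) \<epsilon>)"
      "5 + part (star lam) 1 + length (star lam) \<le> length (flagpole_vec lam (a lam) \<epsilon>)"
      using s by linarith+
    then have "generalized_flagpole star \<mu>"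
      using s g(1,3) unfolding generalized_flagpole_def by blast
    then show "\<mu> \<in> {\<mu>. generalized_flagpole star \<mu> \<and> sum_list \<mu> = k}" using g by simp
  qed
  moreover have "finite {\<mu>. generalized_flagpole star \<mu> \<and> sum_list \<mu> = k}"
    by (rule finite_subset[OF _ finite_partitions_of[of k]])
      (auto simp: generalized_flagpole_def partitions_of_def)
  ultimately have "card S \<le> num_flagpoles star k"
    unfolding num_flagpoles_def by (rule card_inj_on_le)
  moreover have "card (\<Union>j\<in>{1..k - 1}. P j) = (\<Sum>j = 1..k - 1. card (P j))"
  proof (rule card_UN_disjoint)
    show "\<forall>j\<in>{1..k - 1}. finite (P j)"
      using finite_partitions_of unfolding P_def by simp
  qed (auto simp: P_def partitions_of_def)
  then have "card S = (\<Sum>j = 1..k - 1. card (P j)) * 2"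
    by (simp only: S_def card_cartesian_product) simp
  then have "card S = (\<Sum>j = 1..k - 1. 2 * card (P j))"
    unfolding sum_distrib_left[symmetric] by simp
  moreover have "(\<Sum>j = 1..k - 1. 2 * max 0 (int (num_partitions j)
              - 2 * (\<Sum>i = int k - 3 - int j..int j. int (q_count i j)))) \<le> (\<Sum>j = 1..k - 1. int (2 * card (P j)))"
    using P_ge by (intro sum_mono) force
  moreover have "(\<Sum>j = 1..k - 1. int (2 * card (P j))) = int (\<Sum>j = 1..k - 1. 2 * card (P j))"
    by (simp only: of_nat_sum)
  ultimately show ?thesis by linarith
qed

section \<open>Growth of the partition function\<close>

lemma num_partitions_Suc: "num_partitions n \<le> num_partitions (Suc n)"
  unfolding num_partitions_eq
proof (rule card_inj_on_le[of "\<lambda>lam. lam @ [1]"])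
  show "(\<lambda>lam. lam @ [1]) ` partitions_of n \<subseteq> partitions_of (Suc n)"
    by (auto simp: partitions_of_def is_partition_def sorted_wrt_append Suc_le_eq)
qed (auto simp: finite_partitions_of inj_on_def)

lemma num_partitions_mono: "m \<le> n \<Longrightarrow> num_partitions m \<le> num_partitions n"
  by (rule lift_Suc_mono_le[of num_partitions, OF num_partitions_Suc])

lemma partitions_of_0: "partitions_of 0 = {[]}"
proof
  show "partitions_of 0 \<subseteq> {[]}"
  proof
    fix lam assume "lam \<in> partitions_of 0"
    then have "length lam \<le> 0" using length_le_sum_list[of lam] by (simp only: partitions_of_def mem_Collect_eq)
    then show "lam \<in> {[]}" by simp
  qed
qed (simp add: partitions_of_def is_partition_def)

lemma num_partitions_0: "num_partitions 0 = 1"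
  by (simp add: num_partitions_eq partitions_of_0)

lemma num_partitions_pos: "1 \<le> num_partitions n"
  using num_partitions_mono[of 0 n] by (simp add: num_partitions_0)

section \<open>Ratio bounds from counting part sizes\<close>

lemma decreasing_filter_append:
  fixes xs :: "nat list"
  shows "sorted_wrt (\<ge>) xs \<Longrightarrow> filter (\<lambda>x. i \<le> x) xs @ filter (\<lambda>x. x < i) xs = xs"
proof (induction xs)
  case (Cons x xs)
  show ?case
  proof (cases "i \<le> x")
    case False
    then have "\<forall>y\<in>set xs. \<not> i \<le> y" using Cons.prems by auto
    then show ?thesis using False by (auto simp: filter_empty_conv filter_id_conv not_le)
  qed (use Cons in auto)
qed simp

text \<open>A new part \<open>i\<close> is inserted between the parts at least \<open>i\<close> and
  the smaller ones; filtering the result on either side recovers the original.\<close>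

lemma card_partitions_containing:
  assumes "1 \<le> i" "i \<le> n"
  shows "num_partitions (n - i) \<le> card {lam \<in> partitions_of n. i \<in> set lam}"
  unfolding num_partitions_eq
proof (rule card_inj_on_le)
  let ?f = "\<lambda>lam. filter (\<lambda>x. i \<le> x) lam @ i # filter (\<lambda>x. x < i) lam"
  have eq: "filter (\<lambda>x. i \<le> x) lam @ filter (\<lambda>x. x < i) lam = lam" if "lam \<in> partitions_of (n - i)" for lam
    using that by (intro decreasing_filter_append) (simp add: partitions_of_def is_partition_def)
  show "inj_on ?f (partitions_of (n - i))"
  proof (rule inj_onI)
    fix l l' assume l: "l \<in> partitions_of (n - i)" "l' \<in> partitions_of (n - i)" "?f l = ?f l'"
    have "filter (\<lambda>x. i \<le> x) (?f l) = filter (\<lambda>x. i \<le> x) (?f l')" "filter (\<lambda>x. x < i) (?f l) = filter (\<lambda>x. x < i) (?f l')"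
      using l(3) by simp_all
    moreover have "filter (\<lambda>x. i \<le> x \<and> x < i) xs = []" "filter (\<lambda>x. x < i \<and> i \<le> x) xs = []" for xs
      by (simp_all add: filter_empty_conv)
    ultimately have "filter (\<lambda>x. i \<le> x) l = filter (\<lambda>x. i \<le> x) l'" "filter (\<lambda>x. x < i) l = filter (\<lambda>x. x < i) l'"
      by (simp_all add: conj_commute)
    then show "l = l'" using eq[OF l(1)] eq[OF l(2)] by metis
  qed
  show "?f ` partitions_of (n - i) \<subseteq> {lam \<in> partitions_of n. i \<in> set lam}"
  proof
    fix mu assume "mu \<in> ?f ` partitions_of (n - i)"
    then obtain l where l: "l \<in> partitions_of (n - i)" "mu = ?f l" by blast
    have p: "is_partition l" "sum_list l = n - i" using l(1) by (auto simp: partitions_of_def)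
    have "is_partition mu"
      using p(1) assms(1) unfolding l(2) is_partition_def
      by (auto simp: sorted_wrt_append sorted_wrt_filter)
    moreover have "sum_list mu = i + sum_list (filter (\<lambda>x. i \<le> x) l @ filter (\<lambda>x. x < i) l)"
      unfolding l(2) by simp
    then have "sum_list mu = n" unfolding eq[OF l(1)] p(2) using assms(2) by simp
    ultimately show "mu \<in> {lam \<in> partitions_of n. i \<in> set lam}"
      using l(2) by (simp add: partitions_of_def)
  qed
  show "finite {lam \<in> partitions_of n. i \<in> set lam}" using finite_partitions_of by simp
qed

text \<open>In the induction the newly added maximum is at least the new cardinality, so the sum is
  at least 1 + 2 + ... up to the cardinality.\<close>

lemma card_Suc_card_le_sum:
  "finite S \<Longrightarrow> 0 \<notin> S \<Longrightarrow> card S * Suc (card S) \<le> 2 * \<Sum>(S :: nat set)"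
proof (induction rule: finite_linorder_max_induct)
  case (insert b A)
  have "A \<subseteq> {1..<b}" using insert by (auto simp: Suc_le_eq intro: gr0I)
  then have "card A \<le> card {1..<b}" by (intro card_mono) auto
  moreover have "0 < b" using insert by (auto intro: gr0I)
  ultimately have "Suc (card A) \<le> b" by simp
  moreover have "b \<notin> A" using insert by auto
  moreover have "card A * Suc (card A) \<le> 2 * \<Sum>A" using insert by simp
  ultimately show ?case using insert by simp
qed simp

lemma card_set_partition_le:
  assumes "lam \<in> partitions_of n"
  shows "real (card (set lam)) \<le> sqrt (2 * real n)"
proof -
  have "\<Sum>(set lam) \<le> sum_list lam"
    by (induction lam) (auto simp: sum.insert_if)
  moreover have "card (set lam) * Suc (card (set lam)) \<le> 2 * \<Sum>(set lam)"
    by (rule card_Suc_card_le_sum) (use assms in \<open>auto simp: partitions_of_def is_partition_def\<close>)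
  ultimately have "card (set lam) * card (set lam) \<le> 2 * n"
    using assms by (simp add: partitions_of_def)
  then have "(real (card (set lam)))\<^sup>2 \<le> 2 * real n"
    unfolding power2_eq_square by (metis of_nat_le_iff of_nat_mult of_nat_numeral)
  then show ?thesis by (rule real_le_rsqrt)
qed

text \<open>Both sides bound the number of pairs of a partition of \<open>n\<close> and one of its part sizes.\<close>

lemma num_partitions_ratio:
  assumes "m \<le> n"
  shows "real m * real (num_partitions (n - m)) \<le> sqrt (2 * real n) * real (num_partitions n)"
proof -
  have "real m * real (num_partitions (n - m)) = (\<Sum>i\<in>{1..m}. real (num_partitions (n - m)))" by simp
  also have "\<dots> \<le> (\<Sum>i\<in>{1..m}. real (num_partitions (n - i)))"
    by (intro sum_mono) (auto intro!: num_partitions_mono)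
  also have "\<dots> \<le> (\<Sum>i\<in>{1..m}. real (card {lam \<in> partitions_of n. i \<in> set lam}))"
    using assms by (intro sum_mono) (auto intro!: card_partitions_containing)
  also have "\<dots> = (\<Sum>i\<in>{1..m}. \<Sum>lam\<in>partitions_of n. if i \<in> set lam then 1 else 0)"
    by (intro sum.cong) (auto simp: sum.If_cases finite_partitions_of Int_def)
  also have "\<dots> = (\<Sum>lam\<in>partitions_of n. \<Sum>i\<in>{1..m}. if i \<in> set lam then 1 else 0)"
    by (rule sum.swap)
  also have "\<dots> \<le> (\<Sum>lam\<in>partitions_of n. sqrt (2 * real n))"
  proof (intro sum_mono)
    fix lam assume lam: "lam \<in> partitions_of n"
    have "(\<Sum>i\<in>{1..m}. if i \<in> set lam then 1 else 0) = real (card ({1..m} \<inter> set lam))"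
      by (simp add: sum.If_cases Int_def)
    also have "\<dots> \<le> real (card (set lam))" by (intro of_nat_mono card_mono) auto
    also have "\<dots> \<le> sqrt (2 * real n)" by (rule card_set_partition_le[OF lam])
    finally show "(\<Sum>i\<in>{1..m}. if i \<in> set lam then 1 else 0) \<le> sqrt (2 * real n)" .
  qed
  also have "\<dots> = sqrt (2 * real n) * real (num_partitions n)" by (simp add: num_partitions_eq)
  finally show ?thesis .
qed

text \<open>For \<open>m\<close> at least \<open>sqrt (8 * n)\<close> the ratio bound gives a
  doubling of the partition number from \<open>n - m\<close> to \<open>n\<close>; this is iterated
  \<open>q\<close> times.\<close>

lemma num_partitions_ge_power:
  assumes "8 * real N \<le> (real m)\<^sup>2" "q * m + r \<le> N" "0 < m"
  shows "2 ^ q \<le> real (num_partitions (q * m + r))"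
  using assms(2)
proof (induction q)
  case 0
  then show ?case using num_partitions_pos[of r] by simp
next
  case (Suc q)
  let ?n = "Suc q * m + r"
  have "2 * sqrt (2 * real ?n) = sqrt (8 * real ?n)"
    using real_sqrt_mult[of 4 "2 * real ?n"] by simp
  also have "\<dots> \<le> sqrt ((real m)\<^sup>2)"
    using assms(1) Suc.prems by (intro real_sqrt_le_mono) (meson mult_left_mono of_nat_mono order_trans zero_le_numeral)
  finally have s: "2 * sqrt (2 * real ?n) \<le> real m" by simp
  have "real m * (2 * real (num_partitions (q * m + r))) \<le> 2 * sqrt (2 * real ?n) * real (num_partitions ?n)"
    using num_partitions_ratio[of m ?n] by (simp add: algebra_simps)
  also have "\<dots> \<le> real m * real (num_partitions ?n)"
    using s by (intro mult_right_mono) auto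
  finally have "2 * real (num_partitions (q * m + r)) \<le> real (num_partitions ?n)"
    using assms(3) by simp
  moreover have "2 ^ q \<le> real (num_partitions (q * m + r))" using Suc by simp
  ultimately show ?case unfolding power_Suc by linarith
qed

text \<open>A partition of \<open>k\<close> is cut at the part \<open>x\<close> where the partial sums exceed \<open>k - d\<close>; both pieces
  are padded with parts 1.\<close>

lemma num_partitions_split:
  assumes "1 \<le> d" "d \<le> k"
  shows "num_partitions k \<le> (k + 1) ^ 3 * (num_partitions (k - d) * num_partitions d)"
proof -
  let ?F = "\<lambda>(i, x, t, \<alpha>, \<beta>). take i \<alpha> @ x # take t \<beta>"
  let ?D = "{..k} \<times> {..k} \<times> {..k} \<times> partitions_of (k - d) \<times> partitions_of d"
  have "partitions_of k \<subseteq> ?F ` ?D"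
  proof
    fix lam assume "lam \<in> partitions_of k"
    then have lam: "is_partition lam" "sum_list lam = k" by (auto simp: partitions_of_def)
    have "k - d < sum_list (take (length lam) lam)" using lam assms by simp
    then obtain j where j: "j \<le> length lam" "\<forall>i<j. \<not> k - d < sum_list (take i lam)" "k - d < sum_list (take j lam)"
      using ex_least_nat_le[of "\<lambda>j. k - d < sum_list (take j lam)" "length lam"] by blast
    then obtain i where i: "j = Suc i" by (cases j) auto
    have il: "i < length lam" using j i by simp
    have split: "lam = take i lam @ lam ! i # drop (Suc i) lam" using il by (rule id_take_nth_drop)
    have s1: "sum_list (take i lam) \<le> k - d" using j(2)[rule_format, of i] i by simp
    have "sum_list (take j lam) + sum_list (drop j lam) = k"
      using lam(2) by (metis append_take_drop_id sum_list_append)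
    then have s2: "sum_list (drop (Suc i) lam) \<le> d" using j(3) assms unfolding i by linarith
    let ?\<alpha> = "take i lam @ replicate (k - d - sum_list (take i lam)) 1"
    let ?\<beta> = "drop (Suc i) lam @ replicate (d - sum_list (drop (Suc i) lam)) 1"
    have sub: "is_partition (xs @ replicate n 1)" if "is_partition xs" for xs n
      using that by (auto simp: is_partition_def sorted_wrt_append sorted_wrt_replicate Suc_le_eq)
    have "is_partition (take i lam)" "is_partition (drop (Suc i) lam)"
      using lam(1) by (auto simp: is_partition_def sorted_wrt_take sorted_wrt_drop dest: in_set_takeD in_set_dropD)
    then have "?\<alpha> \<in> partitions_of (k - d)" "?\<beta> \<in> partitions_of d"
      using sub s1 s2 by (auto simp: partitions_of_def sum_list_replicate)
    moreover have "length lam \<le> k" using length_le_sum_list[OF lam(1)] lam(2) by simp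
    moreover have "lam ! i \<le> k" using lam(2) member_le_sum_list[of "lam ! i" lam] il by auto
    moreover have "lam = ?F (i, lam ! i, length lam - Suc i, ?\<alpha>, ?\<beta>)"
      using split il by simp
    ultimately have "lam = ?F (i, lam ! i, length lam - Suc i, ?\<alpha>, ?\<beta>)"
      "(i, lam ! i, length lam - Suc i, ?\<alpha>, ?\<beta>) \<in> ?D" using il by simp_all
    then show "lam \<in> ?F ` ?D" by (rule image_eqI)
  qed
  moreover have fin: "finite ?D" using finite_partitions_of by blast
  ultimately have "card (partitions_of k) \<le> card ?D"
    by (meson card_image_le card_mono finite_imageI order_trans)
  also have "card ?D = (k + 1) ^ 3 * (num_partitions (k - d) * num_partitions d)"
    by (simp add: card_cartesian_product num_partitions_eq power3_eq_cube algebra_simps)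
  finally show ?thesis by (simp add: num_partitions_eq)
qed

section \<open>Partitions with a large first part or many parts\<close>

lemma card_part_eq: "card {lam \<in> partitions_of n. lam \<noteq> [] \<and> part lam 1 = s} \<le> num_partitions (n - s)"
proof -
  have "{lam \<in> partitions_of n. lam \<noteq> [] \<and> part lam 1 = s} \<subseteq> (#) s ` partitions_of (n - s)"
  proof
    fix lam assume "lam \<in> {lam \<in> partitions_of n. lam \<noteq> [] \<and> part lam 1 = s}"
    then obtain xs where "lam = s # xs" "lam \<in> partitions_of n" by (cases lam) (auto simp: part_def)
    then show "lam \<in> (#) s ` partitions_of (n - s)"
      by (intro image_eqI[of _ _ xs]) (auto simp: partitions_of_def is_partition_def)
  qed
  then have "card {lam \<in> partitions_of n. lam \<noteq> [] \<and> part lam 1 = s} \<le> card ((#) s ` partitions_of (n - s))"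
    using finite_partitions_of by (intro card_mono) auto
  then show ?thesis unfolding num_partitions_eq using card_image_le[OF finite_partitions_of] order_trans by blast
qed

lemma decreasing_filter_pos:
  fixes xs :: "nat list"
  shows "sorted_wrt (\<ge>) xs \<Longrightarrow>
    xs = filter (\<lambda>x. 0 < x) xs @ replicate (length xs - length (filter (\<lambda>x. 0 < x) xs)) 0"
proof (induction xs)
  case (Cons x xs)
  show ?case
  proof (cases "0 < x")
    case False
    then have *: "\<forall>y\<in>set (x # xs). y = 0" using Cons.prems by auto
    then have "filter (\<lambda>x. 0 < x) (x # xs) = []" by (auto simp: filter_empty_conv)
    moreover have "x # xs = replicate (length (x # xs)) 0" using * by (intro replicate_eqI) auto
    ultimately show ?thesis by simp
  qed (use Cons in auto)
qed simp

text \<open>All parts are lowered by 1 and zeros dropped; knowing \<open>s\<close>, the dropped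
  zeros can be restored.\<close>

lemma card_length_eq: "card {lam \<in> partitions_of n. length lam = s} \<le> num_partitions (n - s)"
proof -
  let ?F = "\<lambda>mu. map Suc (mu @ replicate (s - length mu) 0)"
  have "{lam \<in> partitions_of n. length lam = s} \<subseteq> ?F ` partitions_of (n - s)"
  proof
    fix lam assume "lam \<in> {lam \<in> partitions_of n. length lam = s}"
    then have lam: "is_partition lam" "sum_list lam = n" "length lam = s" by (auto simp: partitions_of_def)
    let ?xs = "map (\<lambda>x. x - 1) lam" and ?mu = "filter (\<lambda>x. 0 < x) (map (\<lambda>x. x - 1) lam)"
    have pos: "\<forall>x\<in>set lam. 0 < x" using lam(1) by (simp add: is_partition_def)
    have "sorted_wrt (\<ge>) lam" using lam(1) by (simp add: is_partition_def)
    then have srt: "sorted_wrt (\<ge>) ?xs"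
      unfolding sorted_wrt_map by (rule sorted_wrt_mono_rel[rotated]) auto
    have xs: "?xs = ?mu @ replicate (s - length ?mu) 0"
      using decreasing_filter_pos[OF srt] lam(3) by simp
    have "map Suc ?xs = lam" using pos by (auto intro!: map_idI)
    then have "lam = ?F ?mu" using arg_cong[OF xs, of "map Suc"] by metis
    moreover have "sum_list ?mu = n - s"
    proof -
      have "sum_list ?xs + length lam = sum_list lam"
        using pos by (induction lam) auto
      moreover have "sum_list ?xs = sum_list ?mu"
        using arg_cong[OF xs, of sum_list] by (simp add: sum_list_replicate)
      ultimately show ?thesis using lam by simp
    qed
    moreover have "is_partition ?mu" by (rule is_partition_filter_pos[OF srt])
    ultimately show "lam \<in> ?F ` partitions_of (n - s)"
      by (intro image_eqI[of _ _ ?mu]) (auto simp: partitions_of_def)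
  qed
  then have "card {lam \<in> partitions_of n. length lam = s} \<le> card (?F ` partitions_of (n - s))"
    using finite_partitions_of by (intro card_mono) auto
  then show ?thesis unfolding num_partitions_eq using card_image_le[OF finite_partitions_of] order_trans by blast
qed

text \<open>Either the largest part or the number of parts is some \<open>s\<close> with
  \<open>m \<le> s \<le> j\<close>. For each of the at most \<open>j\<close> values both cases have
  at most \<open>num_partitions (j - m)\<close> members.\<close>

lemma card_wide_le:
  assumes "2 * int m \<le> i" "1 \<le> m"
  shows "card (wide j i) \<le> 2 * j * num_partitions (j - m)"
proof -
  let ?P = "\<lambda>s. {lam \<in> partitions_of j. lam \<noteq> [] \<and> part lam 1 = s}"
  let ?L = "\<lambda>s. {lam \<in> partitions_of j. length lam = s}"
  have "wide j i \<subseteq> (\<Union>s\<in>{m..j}. ?P s \<union> ?L s)"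
  proof
    fix lam assume lam: "lam \<in> wide j i"
    then have p: "is_partition lam" "sum_list lam = j" "2 * int m + 1 \<le> int (part lam 1) + int (length lam)"
      using assms(1) by (auto simp: wide_def partitions_of_def)
    have ne: "lam \<noteq> []" using p(3) assms(2) by (auto simp: part_def)
    have "part lam 1 + length lam \<le> Suc j" using part_length_le[OF p(1) ne] p(2) by simp
    moreover have "0 < part lam 1" using p(1) ne by (intro part_pos) (auto simp: Suc_le_eq)
    moreover have "0 < length lam" using ne by simp
    ultimately have "part lam 1 \<in> {m..j} \<or> length lam \<in> {m..j}"
      using p(3) unfolding atLeastAtMost_iff by linarith
    then show "lam \<in> (\<Union>s\<in>{m..j}. ?P s \<union> ?L s)" using lam ne by (auto simp: wide_def)
  qed
  then have "card (wide j i) \<le> card (\<Union>s\<in>{m..j}. ?P s \<union> ?L s)"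
    by (intro card_mono) (auto simp: finite_partitions_of)
  also have "\<dots> \<le> (\<Sum>s\<in>{m..j}. card (?P s \<union> ?L s))" by (rule card_UN_le) simp
  also have "\<dots> \<le> (\<Sum>s\<in>{m..j}. 2 * num_partitions (j - m))"
  proof (rule sum_mono)
    fix s assume s: "s \<in> {m..j}"
    have "card (?P s \<union> ?L s) \<le> card (?P s) + card (?L s)" by (rule card_Un_le)
    also have "\<dots> \<le> 2 * num_partitions (j - s)" using card_part_eq[of j s] card_length_eq[of j s] by linarith
    also have "\<dots> \<le> 2 * num_partitions (j - m)" using s by (auto intro!: num_partitions_mono)
    finally show "card (?P s \<union> ?L s) \<le> 2 * num_partitions (j - m)" .
  qed
  also have "\<dots> = (Suc j - m) * (2 * num_partitions (j - m))" by simp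
  also have "\<dots> \<le> j * (2 * num_partitions (j - m))" using assms(2) by (intro mult_right_mono) auto
  finally show ?thesis by (simp add: mult_ac)
qed

subsection \<open>An upper bound\<close>

definition bounded_partitions :: "nat \<Rightarrow> nat \<Rightarrow> nat list set" where
  "bounded_partitions n m = {lam \<in> partitions_of n. \<forall>x\<in>set lam. x \<le> m}"

lemma finite_bounded_partitions: "finite (bounded_partitions n m)"
  using finite_partitions_of by (simp add: bounded_partitions_def)

lemma bounded_partitions_Suc:
  "bounded_partitions n (Suc m) \<subseteq> bounded_partitions n m \<union>
     (if Suc m \<le> n then (#) (Suc m) ` bounded_partitions (n - Suc m) (Suc m) else {})"
proof
  fix lam assume lam: "lam \<in> bounded_partitions n (Suc m)"
  then have p: "is_partition lam" "sum_list lam = n" "\<forall>x\<in>set lam. x \<le> Suc m"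
    by (auto simp: bounded_partitions_def partitions_of_def)
  show "lam \<in> bounded_partitions n m \<union>
     (if Suc m \<le> n then (#) (Suc m) ` bounded_partitions (n - Suc m) (Suc m) else {})"
  proof (cases "Suc m \<in> set lam")
    case False
    then have "\<forall>x\<in>set lam. x \<le> m" using p(3) by (metis le_Suc_eq)
    then show ?thesis using p by (auto simp: bounded_partitions_def partitions_of_def)
  next
    case True
    then obtain x xs where l: "lam = x # xs" by (cases lam) auto
    then have x: "x = Suc m" using True p(1,3) by (auto simp: is_partition_def intro: le_antisym)
    then have "Suc m \<le> n" using p(2) l by simp
    moreover have "xs \<in> bounded_partitions (n - Suc m) (Suc m)"
      using p l x by (auto simp: bounded_partitions_def partitions_of_def is_partition_def)
    ultimately show ?thesis using l x by simp
  qed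
qed

text \<open>This is the generating function bound: the count is at most \<open>x^(-n)\<close> times
  the product of \<open>1/(1 - x^i)\<close> with \<open>x = 1/(1 + t)\<close>, and
  \<open>1/(1 - x^i) \<le> 1 + 1/(i t) \<le> exp (1/(i t))\<close>. The induction follows the split
  by whether the part \<open>Suc m\<close> occurs.\<close>

lemma card_bounded_partitions_le:
  assumes t: "0 < (t::real)"
  shows "real (card (bounded_partitions n m)) \<le> (1 + t) ^ n * exp (\<Sum>i=1..m. 1 / (real i * t))"
proof (induction m arbitrary: n)
  case 0
  have "lam = []" if "lam \<in> bounded_partitions n 0" for lam
    using that by (cases lam) (auto simp: bounded_partitions_def partitions_of_def is_partition_def)
  then have "bounded_partitions n 0 \<subseteq> {[]}" by blast
  then have "card (bounded_partitions n 0) \<le> card {[] :: nat list}" by (intro card_mono) auto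
  then have "card (bounded_partitions n 0) \<le> 1" by simp
  moreover have "1 \<le> (1 + t) ^ n" using t by (intro one_le_power) simp
  ultimately show ?case by simp
next
  case (Suc m)
  note IHm = Suc.IH
  let ?s = "real (Suc m) * t"
  let ?E = "exp (\<Sum>i=1..m. 1 / (real i * t))" and ?E' = "exp (\<Sum>i=1..Suc m. 1 / (real i * t))"
  have s: "0 < ?s" using t by simp
  have E': "?E' = ?E * exp (1 / ?s)" by (simp add: exp_add)
  have "1 + 1 / ?s \<le> exp (1 / ?s)" by (rule exp_ge_add_one_self)
  then have "?E * (1 + 1 / ?s) \<le> ?E'" unfolding E' by (intro mult_left_mono) auto
  then have "?E * (?s + 1) \<le> ?s * ?E'" using s by (simp add: field_simps)
  moreover have "1 + ?s \<le> (1 + t) ^ Suc m" using Bernoulli_inequality[of t "Suc m"] t by simp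
  have Ele: "?E \<le> ?E'" unfolding E' using s by (simp add: mult_le_cancel_left1)
  \<comment> \<open>Divided by the power of \<open>1 + t\<close>, this says that \<open>?E\<close>
    is at most \<open>?E'\<close> times \<open>1 - x^(m + 1)\<close>, which is what the recursion
    needs.\<close>
  have key: "?E * (1 + t) ^ Suc m + ?E' \<le> ?E' * (1 + t) ^ Suc m"
  proof -

    have "?E \<le> ?E' * (?s / (1 + ?s))" using calculation s by (simp add: field_simps)
    then have "?E * (1 + t) ^ Suc m \<le> ?E' * (?s / (1 + ?s)) * (1 + t) ^ Suc m"
      using t by (intro mult_right_mono) auto
    also have "\<dots> = ?E' * (1 + t) ^ Suc m - ?E' * ((1 + t) ^ Suc m / (1 + ?s))"
    proof -
      have "?s / (1 + ?s) = 1 - 1 / (1 + ?s)" using s by (simp add: field_simps)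
      then show ?thesis by (simp only:) (simp add: algebra_simps)
    qed
    also have "\<dots> \<le> ?E' * (1 + t) ^ Suc m - ?E' * 1"
      using \<open>1 + ?s \<le> (1 + t) ^ Suc m\<close> s by (intro diff_left_mono mult_left_mono) (auto simp: le_divide_eq)
    finally show ?thesis by simp
  qed
  show ?case
  proof (induction n rule: less_induct)
    case (less n)
    show ?case
    proof (cases "Suc m \<le> n")
      case False
      then have "card (bounded_partitions n (Suc m)) \<le> card (bounded_partitions n m)"
        using bounded_partitions_Suc[of n m] finite_bounded_partitions by (intro card_mono) auto
      then have "real (card (bounded_partitions n (Suc m))) \<le> (1 + t) ^ n * ?E" using IHm[of n] by linarith
      also have "\<dots> \<le> (1 + t) ^ n * ?E'" using Ele t by (intro mult_left_mono) auto
      finally show ?thesis .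
    next
      case True
      let ?C = "(#) (Suc m) ` bounded_partitions (n - Suc m) (Suc m)"
      have "card (bounded_partitions n (Suc m)) \<le> card (bounded_partitions n m \<union> ?C)"
        using bounded_partitions_Suc[of n m] True finite_bounded_partitions by (intro card_mono) auto
      also have "\<dots> \<le> card (bounded_partitions n m) + card ?C" by (rule card_Un_le)
      also have "\<dots> \<le> card (bounded_partitions n m) + card (bounded_partitions (n - Suc m) (Suc m))"
        by (intro add_left_mono card_image_le finite_bounded_partitions)
      finally have "real (card (bounded_partitions n (Suc m))) \<le>
          (1 + t) ^ n * ?E + (1 + t) ^ (n - Suc m) * ?E'"
        using IHm[of n] less[of "n - Suc m"] True by linarith
      also have pw: "(1 + t) ^ n = (1 + t) ^ (n - Suc m) * (1 + t) ^ Suc m"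
        unfolding power_add[symmetric] using True by simp
      also have "(1 + t) ^ (n - Suc m) * (1 + t) ^ Suc m * ?E + (1 + t) ^ (n - Suc m) * ?E'
          = (1 + t) ^ (n - Suc m) * (?E * (1 + t) ^ Suc m + ?E')"
        by (simp only: distrib_left mult_ac)
      also have "\<dots> \<le> (1 + t) ^ (n - Suc m) * (?E' * (1 + t) ^ Suc m)"
        using key t by (intro mult_left_mono) auto
      also have "\<dots> = (1 + t) ^ n * ?E'" unfolding pw by (simp only: mult_ac)
      finally show ?thesis .
    qed
  qed
qed

lemma sum_inverse_le: "1 \<le> n \<Longrightarrow> (\<Sum>i=1..n. 1 / real i) \<le> 1 + ln (real n)"
proof (induction n rule: dec_induct)
  case (step n)
  have "ln (real n / real (Suc n)) \<le> real n / real (Suc n) - 1"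
    using step by (intro ln_le_minus_one) auto
  then have "1 / real (Suc n) \<le> ln (real (Suc n)) - ln (real n)"
    using step by (simp add: ln_div field_simps)
  then show ?case using step by simp
qed simp

lemma num_partitions_le:
  assumes "1 \<le> n"
  shows "ln (real (num_partitions n)) \<le> sqrt (real n) * (2 + ln (real n))"
proof -
  \<comment> \<open>This choice balances the two factors: the power is at most
    \<open>exp (sqrt n)\<close>, and the harmonic sum is multiplied by
    \<open>sqrt n\<close>.\<close>
  let ?t = "1 / sqrt (real n)"
  have t: "0 < ?t" using assms by simp
  have "\<forall>x\<in>set lam. x \<le> n" if "lam \<in> partitions_of n" for lam
    using that member_le_sum_list by (auto simp: partitions_of_def)
  then have "bounded_partitions n n = partitions_of n" by (auto simp: bounded_partitions_def)
  then have "num_partitions n = card (bounded_partitions n n)" by (simp only: num_partitions_eq)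
  then have "real (num_partitions n) \<le> (1 + ?t) ^ n * exp (\<Sum>i=1..n. 1 / (real i * ?t))"
    using card_bounded_partitions_le[OF t] by simp
  also have "(\<Sum>i=1..n. 1 / (real i * ?t)) = sqrt (real n) * (\<Sum>i=1..n. 1 / real i)"
    by (simp add: sum_distrib_left)
  also have "(1 + ?t) ^ n \<le> exp ?t ^ n"
    using exp_ge_add_one_self[of ?t] t by (intro power_mono) auto
  also have "exp ?t ^ n = exp (sqrt (real n))"
    using assms by (simp add: exp_of_nat_mult[symmetric] real_div_sqrt)
  also have "exp (sqrt (real n)) * exp (sqrt (real n) * (\<Sum>i=1..n. 1 / real i))
      \<le> exp (sqrt (real n)) * exp (sqrt (real n) * (1 + ln (real n)))"
    using sum_inverse_le[OF assms] by (intro mult_left_mono) (auto intro: mult_left_mono)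
  also have "\<dots> = exp (sqrt (real n) * (2 + ln (real n)))"
    by (simp add: algebra_simps flip: exp_add)
  finally have "real (num_partitions n) \<le> exp (sqrt (real n) * (2 + ln (real n)))" by simp
  then have "ln (real (num_partitions n)) \<le> ln (exp (sqrt (real n) * (2 + ln (real n))))"
    using num_partitions_pos[of n] by (subst ln_le_cancel_iff) auto
  then show ?thesis by simp
qed

section \<open>Lower bound and asymptotic comparison\<close>

lemma ln_num_partitions_ge:
  assumes "1 \<le> k"
  shows "(sqrt (real k) / 4 - 1) * ln 2 \<le> ln (real (num_partitions k))"
proof -
  \<comment> \<open>This is the least integer step over which doubling is guaranteed up to
    \<open>k\<close>. It is at most \<open>4 * sqrt k\<close>, so there are at least
    \<open>sqrt k / 4 - 1\<close> doublings.\<close>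
  define M where "M = nat \<lceil>sqrt (8 * real k)\<rceil>"
  have s1: "1 \<le> sqrt (real k)" using assms by simp
  have M: "sqrt (8 * real k) \<le> real M" "real M \<le> sqrt (8 * real k) + 1"
    unfolding M_def by (auto intro: real_nat_ceiling_ge)
  have "sqrt 8 \<le> (3::real)" by (rule real_le_lsqrt) auto
  then have "sqrt (8 * real k) \<le> 3 * sqrt (real k)" by (simp add: real_sqrt_mult mult_right_mono)
  then have M4: "real M \<le> 4 * sqrt (real k)" using M(2) s1 by linarith
  have "0 < sqrt (8 * real k)" using assms by simp
  then have M0: "0 < M" using M(1) by linarith
  have "8 * real k = (sqrt (8 * real k))\<^sup>2" by simp
  also have "\<dots> \<le> (real M)\<^sup>2" using M(1) by (intro power_mono) auto
  finally have "2 ^ (k div M) \<le> real (num_partitions (k div M * M + k mod M))"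
    by (rule num_partitions_ge_power) (use M0 in auto)
  then have p: "2 ^ (k div M) \<le> real (num_partitions k)" by simp
  have "k < Suc (k div M) * M" using dividend_less_div_times[OF M0, of k] by simp
  then have "real k \<le> real (Suc (k div M) * M)" by linarith
  then have "sqrt (real k) * sqrt (real k) \<le> (real (k div M) + 1) * real M" by (simp add: algebra_simps)
  also have "\<dots> \<le> (real (k div M) + 1) * (4 * sqrt (real k))" using M4 by (intro mult_left_mono) auto
  finally have "sqrt (real k) * sqrt (real k) \<le> ((real (k div M) + 1) * 4) * sqrt (real k)" by (simp only: mult_ac)
  then have "sqrt (real k) \<le> (real (k div M) + 1) * 4" by (rule mult_right_le_imp_le) (use s1 in linarith)
  then have "(sqrt (real k) / 4 - 1) * ln 2 \<le> real (k div M) * ln 2" by (intro mult_right_mono) auto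
  also have "\<dots> = ln (2 ^ (k div M))" by (simp add: ln_realpow)
  also have "\<dots> \<le> ln (real (num_partitions k))" using p num_partitions_pos[of k] by (subst ln_le_cancel_iff) auto
  finally show ?thesis .
qed

lemma num_partitions_ratio_cubed:
  assumes "3 * m \<le> j" "j \<le> k"
  shows "real m ^ 3 * real (num_partitions (j - 3 * m)) \<le> sqrt (2 * real k) ^ 3 * real (num_partitions j)"
proof -
  let ?s = "sqrt (2 * real k)"
  have step: "real m * real (num_partitions (n - m)) \<le> ?s * real (num_partitions n)" if "m \<le> n" "n \<le> k" for n
  proof -
    have "sqrt (2 * real n) * real (num_partitions n) \<le> ?s * real (num_partitions n)"
      using that by (intro mult_right_mono) auto
    then show ?thesis using num_partitions_ratio[OF that(1)] by linarith
  qed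
  have e: "j - 3 * m = j - m - m - m" by simp
  have "real m ^ 3 * real (num_partitions (j - 3 * m)) = real m ^ 2 * (real m * real (num_partitions (j - m - m - m)))"
    unfolding e by (simp add: power3_eq_cube power2_eq_square)
  also have "\<dots> \<le> real m ^ 2 * (?s * real (num_partitions (j - m - m)))"
    using assms by (intro mult_left_mono step) auto
  also have "\<dots> = real m * ?s * (real m * real (num_partitions (j - m - m)))"
    by (simp add: power2_eq_square)
  also have "\<dots> \<le> real m * ?s * (?s * real (num_partitions (j - m)))"
    using assms by (intro mult_left_mono step) auto
  also have "\<dots> = ?s ^ 2 * (real m * real (num_partitions (j - m)))"
    by (simp add: power2_eq_square del: real_sqrt_mult)
  also have "\<dots> \<le> ?s ^ 2 * (?s * real (num_partitions j))"
    using assms by (intro mult_left_mono step) auto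
  also have "\<dots> = ?s ^ 3 * real (num_partitions j)"
    by (simp add: power3_eq_cube power2_eq_square del: real_sqrt_mult)
  finally show ?thesis .
qed

text \<open>With \<open>r\<close> uses of the ratio bound, beating the factor \<open>8 * k\<close>
  needs \<open>m\<close> of order \<open>k^(1/2 + 1/r)\<close>. Three is the first \<open>r\<close>
  for which this exponent, 5/6, leaves \<open>m\<close> of smaller order than
  \<open>k\<close>.\<close>

lemma num_flagpoles_ge_num_partitions:
  assumes star: "size_preserving_involution star"
    and "1 \<le> m" "9 * m + 4 \<le> k" "8 * real k * sqrt (2 * real k) ^ 3 \<le> real m ^ 3"
  shows "num_partitions (k - (6 * m + 3)) \<le> num_flagpoles star k"
proof -
  \<comment> \<open>The lower summation limit \<open>k - 3 - j\<close> becomes \<open>6 * m\<close>,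
    which is twice the \<open>3 * m\<close> required by \<open>card_wide_le\<close>.\<close>
  define j where "j = k - (6 * m + 3)"
  let ?f = "\<lambda>j. 2 * max 0 (int (num_partitions j)
              - 2 * (\<Sum>i = int k - 3 - int j..int j. int (q_count i j)))"
  have j: "1 \<le> j" "j \<le> k - 1" "3 * m \<le> j" "j \<le> k" "int k - 3 - int j = 2 * int (3 * m)"
    using assms(2,3) by (auto simp: j_def)
  have pos: "0 < sqrt (2 * real k) ^ 3" using assms(3) by simp
  have "sqrt (2 * real k) ^ 3 * (8 * real k * real (num_partitions (j - 3 * m)))
      = (8 * real k * sqrt (2 * real k) ^ 3) * real (num_partitions (j - 3 * m))"
    by (simp only: mult_ac)
  also have "\<dots> \<le> real m ^ 3 * real (num_partitions (j - 3 * m))"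
    using assms(4) by (intro mult_right_mono) auto
  also have "\<dots> \<le> sqrt (2 * real k) ^ 3 * real (num_partitions j)"
    by (rule num_partitions_ratio_cubed[OF j(3,4)])
  finally have "8 * real k * real (num_partitions (j - 3 * m)) \<le> real (num_partitions j)"
    using pos by (rule mult_left_le_imp_le)
  then have "real (8 * k * num_partitions (j - 3 * m)) \<le> real (num_partitions j)" by simp
  then have r: "8 * k * num_partitions (j - 3 * m) \<le> num_partitions j" by (simp only: of_nat_le_iff)
  have "card (wide j (int k - 3 - int j)) \<le> 2 * j * num_partitions (j - 3 * m)"
    by (rule card_wide_le) (use j assms(2) in auto)
  also have "\<dots> \<le> 2 * k * num_partitions (j - 3 * m)" using j by (intro mult_right_mono) auto
  finally have "4 * card (wide j (int k - 3 - int j)) \<le> num_partitions j" using r by linarith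
  then have "int (4 * card (wide j (int k - 3 - int j))) \<le> int (num_partitions j)"
    by (simp only: of_nat_le_iff)
  \<comment> \<open>The outer factor 2 compensates the loss of at most half of
    \<open>num_partitions j\<close>.\<close>
  then have "int (num_partitions j) \<le> 2 * (int (num_partitions j) - 2 * int (card (wide j (int k - 3 - int j))))"
    by simp
  also have "\<dots> \<le> ?f j"
    unfolding sum_q_count[OF j(1)] by (intro mult_left_mono) auto
  also have "?f j \<le> (\<Sum>j = 1..k - 1. ?f j)"
    by (rule member_le_sum[of j]) (use j in auto)
  also have "\<dots> \<le> int (num_flagpoles star k)" by (rule num_flagpoles_ge[OF star])
  finally show ?thesis by (simp add: j_def)
qed

lemma num_flagpoles_asymp:
  fixes c :: real
  assumes star: "size_preserving_involution star" and c: "c < 1"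
  shows "\<forall>\<^sub>F k in sequentially. real (num_flagpoles star k) > real (num_partitions k) powr c"
proof -
  define e where "e = 1 - c"
  have e: "0 < e" using c by (simp add: e_def)
  \<comment> \<open>The numerator bounds the logarithmic loss from
    \<open>num_partitions_split\<close>, the denominator bounds \<open>ln (num_partitions k)\<close>
    from below. The exponent 9/10 lies between 5/6, needed for \<open>ev3\<close>, and 1, needed for
    \<open>ev2\<close> and for this limit.\<close>
  have "((\<lambda>k. (sqrt (6 * real k powr (9/10) + 3) * (2 + ln (real k)) + 3 * ln (real k + 1)) /
      ((sqrt (real k) / 4 - 1) * ln 2)) \<longlongrightarrow> 0) sequentially"
    by real_asymp
  then have ev1: "\<forall>\<^sub>F k in sequentially. (sqrt (6 * real k powr (9/10) + 3) * (2 + ln (real k)) + 3 * ln (real k + 1)) /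
      ((sqrt (real k) / 4 - 1) * ln 2) < e"
    using e by (rule order_tendstoD)
  have ev2: "\<forall>\<^sub>F k in sequentially. 9 * real k powr (9/10) + 4 \<le> real k"
    by real_asymp
  have ev3: "\<forall>\<^sub>F k in sequentially. 8 * real k * sqrt (2 * real k) ^ 3 \<le> (real k powr (9/10) - 1) ^ 3"
    by real_asymp
  have ev4: "\<forall>\<^sub>F k in sequentially. 2 \<le> real k powr (9/10)"
    by real_asymp
  have ev5: "\<forall>\<^sub>F k in sequentially. 0 < (sqrt (real k) / 4 - 1) * ln 2"
    by real_asymp
  show ?thesis
    using ev1 ev2 ev3 ev4 ev5 eventually_gt_at_top[of 0]
  proof eventually_elim
    case (elim k)
    define x where "x = real k powr (9/10)"
    define m where "m = nat \<lfloor>x\<rfloor>"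
    define d where "d = 6 * m + 3"
    have m: "real m \<le> x" "x - 1 \<le> real m"
      using elim(4) unfolding m_def x_def by linarith+
    have m1: "1 \<le> m" using m elim(4) by (simp add: x_def)
    have "real (9 * m + 4) \<le> real k" using m(1) elim(2) by (simp add: x_def)
    then have mk: "9 * m + 4 \<le> k" by (simp only: of_nat_le_iff)
    have "(x - 1) ^ 3 \<le> real m ^ 3" using m elim(4) by (intro power_mono) (auto simp: x_def)
    then have "8 * real k * sqrt (2 * real k) ^ 3 \<le> real m ^ 3" using elim(3) by (simp add: x_def)
    from num_flagpoles_ge_num_partitions[OF star m1 mk this]
    have g: "num_partitions (k - d) \<le> num_flagpoles star k" by (simp add: d_def)
    have d: "1 \<le> d" "d \<le> k" using mk by (auto simp: d_def)
    have p0: "0 < real (num_partitions n)" for n using num_partitions_pos[of n] by simp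
    let ?P = "\<lambda>n. ln (real (num_partitions n))"
    have "real (num_partitions k) \<le> real ((k + 1) ^ 3 * (num_partitions (k - d) * num_partitions d))"
      using num_partitions_split[OF d] by (simp only: of_nat_le_iff)
    then have "?P k \<le> ln (real ((k + 1) ^ 3 * (num_partitions (k - d) * num_partitions d)))"
      using p0[of k] by (intro ln_mono) auto
    also have "\<dots> = 3 * ln (real k + 1) + ?P (k - d) + ?P d"
      using p0 num_partitions_pos[of "k - d"] num_partitions_pos[of d]
      by (simp add: ln_mult ln_realpow add.commute)
    finally have 1: "?P k \<le> 3 * ln (real k + 1) + ?P (k - d) + ?P d" .
    have "?P d \<le> sqrt (real d) * (2 + ln (real d))" by (rule num_partitions_le[OF d(1)])
    also have "\<dots> \<le> sqrt (6 * x + 3) * (2 + ln (real k))"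
    proof (intro mult_mono)
      show "sqrt (real d) \<le> sqrt (6 * x + 3)" using m(1) by (simp add: d_def)
      show "2 + ln (real d) \<le> 2 + ln (real k)" using d by simp
      show "0 \<le> sqrt (6 * x + 3)" using m by simp
      show "0 \<le> 2 + ln (real d)" using d by simp
    qed
    finally have 2: "?P d \<le> sqrt (6 * x + 3) * (2 + ln (real k))" .
    \<comment> \<open>The loss is less than \<open>e = 1 - c\<close> times \<open>?P k\<close>, so
      more than \<open>c * ?P k\<close> remains for \<open>?P (k - d)\<close>.\<close>
    have "sqrt (6 * x + 3) * (2 + ln (real k)) + 3 * ln (real k + 1) < e * ((sqrt (real k) / 4 - 1) * ln 2)"
      using elim(1,5) by (simp only: x_def pos_divide_less_eq)
    also have "\<dots> \<le> e * ?P k"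
      using e elim(6) by (intro mult_left_mono ln_num_partitions_ge) auto
    finally have "c * ?P k < ?P (k - d)"
      using 1 2 by (simp add: e_def algebra_simps)
    then have "exp (c * ?P k) < exp (?P (k - d))" by simp
    then have "real (num_partitions k) powr c < real (num_partitions (k - d))"
      using p0 num_partitions_pos[of k] num_partitions_pos[of "k - d"] by (simp add: powr_def)
    then show ?case using g by linarith
  qed
qed

theorem theorem8p3:
  fixes star :: "nat list \<Rightarrow> nat list"
  assumes "size_preserving_involution star"
  shows "(\<forall>k::nat. int (num_flagpoles star k) \<ge>
           (\<Sum>j = 1..k - 1. 2 * max 0 (int (num_partitions j)
              - 2 * (\<Sum>i = int k - 3 - int j..int j. int (q_count i j))))) \<and>
         (\<forall>c::real. c < 1 \<longrightarrow>
           (\<forall>\<^sub>F k in sequentially. real (num_flagpoles star k) > real (num_partitions k) powr c))"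
  using num_flagpoles_ge[OF assms] num_flagpoles_asymp[OF assms] by blast

end
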